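(* Let $m,n$ be positive integers and let $s$ be an integer relatively prime to $n$ such that $s$ has order $m$ modulo $n$ and $s$ has order $m$ modulo $q$ for every prime divisor $q$ of $n$. Let $G_{m,n}^\star=\langle x, y\mid x^m=y^n=1,\ x^{-1}yx=y^s\rangle$. Let $S$ be a sequence over $G_{m,n}^\star$ with $|S|=\mathsf d(G_{m,n}^\star)=m+n-2$. Then $S$ is product-one free if and only if $S$ is of one of the following forms: (a) If $G_{m,n}^\star\not\cong G_{2,3}$, then $$S=(x^ay^{b_1})\cdot\ldots\cdot (x^ay^{b_{m-1}})\cdot (y^c)^{[n-1]},$$ where $a,c,b_1,\ldots,b_{m-1}\in \mathbb{N}$ with $\gcd(a,m)=\gcd(c,n)=1$; (b) If $G_{m,n}^\star\cong G_{2,3}$, then $S=x\cdot xy\cdot xy^2$ (the sequence of length 3 with terms $x$, $xy$, $xy^2$), or $S= xy^{b}\cdot (y^{c})^{[2]}$ where $b\in \{0,1,2\}$ and $c\in\{1,2\}$.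
   Context: For an integer $s$ relatively prime to a positive integer $n$, the order of $s$ modulo $n$ is the least positive integer $k$ with $s^k\equiv 1\pmod n$. The group $G_{2,3}$ is $\langle x,y\mid x^2=y^3=1,\ x^{-1}yx=y^s\rangle$ with $s$ of order $2$ modulo $3$ (i.e. $s\equiv -1 \pmod 3$). A sequence over a finite group $G$ (written multiplicatively, identity $1$) is a finite unordered sequence of elements of $G$ with repetition allowed (i.e. a finite multiset). The dot $\cdot$ in the displayed forms denotes concatenation of sequences (multiset union), not multiplication in the group; $g^{[k]}$ denotes the sequence consisting of $k$ copies of $g$; juxtaposition such as $x^ay^b$ denotes the product in the group. $|S|$ is the number of terms of $S$ counted with multiplicity. A subsequence of $S$ is a sub-multiset. A sequence $g_1,\ldots,g_\ell$ is product-one if $g_{\tau(1)}g_{\tau(2)}\cdots g_{\tau(\ell)}=1$ for some permutation $\tau$ of $\{1,\ldots,\ell\}$. A sequence $S$ is product-one free if it has no nonempty product-one subsequence. The small Davenport constant $\mathsf d(G)$ is the maximal integer $\ell$ such that there is a product-one free sequence over $G$ of length $\ell$. *)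

theory Defs
  imports
    "HOL-Number_Theory.Number_Theory"
    "HOL-Algebra.Group"
    "HOL-Library.Multiset"
begin

section \<open>Groups given by generators and relations\<close>

datatype 'g letter = Gen 'g | Inv 'g

primrec inv_letter :: "'g letter \<Rightarrow> 'g letter" where
  "inv_letter (Gen a) = Inv a"
| "inv_letter (Inv a) = Gen a"

type_synonym 'g word = "'g letter list"

definition inv_word :: "'g word \<Rightarrow> 'g word" where
  "inv_word w = rev (map inv_letter w)"

definition word_power :: "'g word \<Rightarrow> int \<Rightarrow> 'g word" where
  "word_power w k = concat (replicate (nat \<bar>k\<bar>) (if k \<ge> 0 then w else inv_word w))"

text \<open>
  A set \<open>R\<close> of pairs of words represents the defining relations \<open>l = r\<close>, \<open>(l, r) \<in> R\<close>. Two words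
  denote the same element of the presented group iff they are identified by the least congruence
  on the monoid of words that makes formally inverse letters inverse and contains \<open>R\<close>.
\<close>

inductive pres_eq :: "('g word \<times> 'g word) set \<Rightarrow> 'g word \<Rightarrow> 'g word \<Rightarrow> bool"
  for R where
  refl: "pres_eq R w w"
| sym: "pres_eq R u v \<Longrightarrow> pres_eq R v u"
| trans: "pres_eq R u v \<Longrightarrow> pres_eq R v w \<Longrightarrow> pres_eq R u w"
| cancel: "pres_eq R (u @ [a, inv_letter a] @ v) (u @ v)"
| relation: "(l, r) \<in> R \<Longrightarrow> pres_eq R (u @ l @ v) (u @ r @ v)"

definition pres_class :: "('g word \<times> 'g word) set \<Rightarrow> 'g word \<Rightarrow> 'g word set" where
  "pres_class R w = {v. pres_eq R w v}"

definition presented_group :: "('g word \<times> 'g word) set \<Rightarrow> 'g word set monoid" where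
  "presented_group R =
     \<lparr>carrier = range (pres_class R),
      mult = (\<lambda>A B. {w. \<exists>u\<in>A. \<exists>v\<in>B. pres_eq R (u @ v) w}),
      one = pres_class R []\<rparr>"

lemma pres_eq_context:
  assumes "pres_eq R u v"
  shows "pres_eq R (p @ u @ q) (p @ v @ q)"
  using assms
proof induction
  case (cancel u a v)
  show ?case using pres_eq.cancel[of R "p @ u" a "v @ q"] by simp
next
  case (relation l r u v)
  then show ?case using pres_eq.relation[of l r R "p @ u" "v @ q"] by simp
qed (blast intro: pres_eq.intros)+

lemma pres_eq_append:
  assumes "pres_eq R u u'" "pres_eq R v v'"
  shows "pres_eq R (u @ v) (u' @ v')"
  using pres_eq_context[OF assms(1), of "[]" v] pres_eq_context[OF assms(2), of u' "[]"]
  by (auto intro: pres_eq.trans)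

lemma pres_class_eq_iff: "pres_class R u = pres_class R v \<longleftrightarrow> pres_eq R u v"
  unfolding pres_class_def by (auto intro: pres_eq.intros)

lemma mult_pres_class:
  "pres_class R u \<otimes>\<^bsub>presented_group R\<^esub> pres_class R v = pres_class R (u @ v)"
  unfolding presented_group_def pres_class_def
  by (auto intro: pres_eq.intros pres_eq_append)

lemma inv_inv_letter [simp]: "inv_letter (inv_letter a) = a"
  by (cases a) auto

lemma pres_eq_inv_word: "pres_eq R (inv_word w @ w) []"
proof (induction w)
  case Nil
  show ?case by (simp add: inv_word_def pres_eq.refl)
next
  case (Cons a w)
  have "pres_eq R (inv_word w @ [inv_letter a, inv_letter (inv_letter a)] @ w) (inv_word w @ w)"
    by (rule pres_eq.cancel)
  with Cons show ?case by (auto simp: inv_word_def intro: pres_eq.trans)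
qed

lemma carrier_presented_group: "carrier (presented_group R) = range (pres_class R)"
  and one_presented_group: "\<one>\<^bsub>presented_group R\<^esub> = pres_class R []"
  by (simp_all add: presented_group_def)

lemma group_presented_group: "group (presented_group R)"
proof (rule groupI)
  fix x assume "x \<in> carrier (presented_group R)"
  then obtain w where "x = pres_class R w" by (auto simp: carrier_presented_group)
  then have "pres_class R (inv_word w) \<otimes>\<^bsub>presented_group R\<^esub> x = \<one>\<^bsub>presented_group R\<^esub>"
    by (simp add: mult_pres_class one_presented_group pres_class_eq_iff pres_eq_inv_word)
  then show "\<exists>y\<in>carrier (presented_group R). y \<otimes>\<^bsub>presented_group R\<^esub> x = \<one>\<^bsub>presented_group R\<^esub>"
    by (auto simp: carrier_presented_group)
qed (auto simp: carrier_presented_group one_presented_group mult_pres_class)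


section \<open>The groups \<open>\<langle>x, y | x\<^sup>m = y\<^sup>n = 1, x\<^sup>-\<^sup>1 y x = y\<^sup>s\<rangle>\<close>\<close>

datatype gens = X | Y

definition metacyclic_relations :: "nat \<Rightarrow> nat \<Rightarrow> int \<Rightarrow> (gens word \<times> gens word) set" where
  "metacyclic_relations m n s =
     {(word_power [Gen X] (int m), []),
      (word_power [Gen Y] (int n), []),
      ([Inv X, Gen Y, Gen X], word_power [Gen Y] s)}"

definition metacyclic :: "nat \<Rightarrow> nat \<Rightarrow> int \<Rightarrow> gens word set monoid" where
  "metacyclic m n s = presented_group (metacyclic_relations m n s)"

definition gen_x :: "nat \<Rightarrow> nat \<Rightarrow> int \<Rightarrow> gens word set" where
  "gen_x m n s = pres_class (metacyclic_relations m n s) [Gen X]"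

definition gen_y :: "nat \<Rightarrow> nat \<Rightarrow> int \<Rightarrow> gens word set" where
  "gen_y m n s = pres_class (metacyclic_relations m n s) [Gen Y]"

text \<open>
  Integers \<open>s\<close> of order 2 modulo 3 are exactly those congruent to \<open>-1\<close>; since \<open>y\<^sup>3 = 1\<close>, they all
  give the same group up to isomorphism, so \<open>s = -1\<close> is taken.
\<close>

definition G23 :: "gens word set monoid" where
  "G23 = metacyclic 2 3 (-1)"


section \<open>Product-one sequences\<close>

definition seq_over :: "('a, 'b) monoid_scheme \<Rightarrow> 'a multiset \<Rightarrow> bool" where
  "seq_over G S \<longleftrightarrow> set_mset S \<subseteq> carrier G"

text \<open>The orderings of the terms of \<open>S\<close> are the lists \<open>gs\<close> with \<open>mset gs = S\<close>.\<close>

definition product_one :: "('a, 'b) monoid_scheme \<Rightarrow> 'a multiset \<Rightarrow> bool" where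
  "product_one G S \<longleftrightarrow> (\<exists>gs. mset gs = S \<and> foldr (\<otimes>\<^bsub>G\<^esub>) gs \<one>\<^bsub>G\<^esub> = \<one>\<^bsub>G\<^esub>)"

definition product_one_free :: "('a, 'b) monoid_scheme \<Rightarrow> 'a multiset \<Rightarrow> bool" where
  "product_one_free G S \<longleftrightarrow> (\<forall>T. T \<subseteq># S \<and> T \<noteq> {#} \<longrightarrow> \<not> product_one G T)"

definition small_davenport :: "('a, 'b) monoid_scheme \<Rightarrow> nat" where
  "small_davenport G =
     (GREATEST l. \<exists>S. seq_over G S \<and> product_one_free G S \<and> size S = l)"

end

theory Submission
  imports Defs "HOL-Algebra.Elementary_Groups" "HOL-Combinatorics.Permutations"
begin

text \<open>
  Write elements as pairs \<open>(i, j)\<close> for \<open>x\<^sup>i y\<^sup>j\<close>; the hypothesis on the orders makes \<open>s\<^sup>i - 1\<close> a unit modulo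
  \<open>n\<close> for \<open>0 < i < m\<close>. A minimal subsequence \<open>T\<close> whose product lies in \<open>\<langle>y\<rangle>\<close> can be rotated, and the
  rotations give \<open>|T|\<close> distinct elements of \<open>\<langle>y\<rangle>\<close>. Adding up such sets with the Kemperman--Scherk theorem,
  a product-one free sequence with product in \<open>\<langle>y\<rangle>\<close> realises at least \<open>|S| + 1\<close> elements of \<open>\<langle>y\<rangle>\<close>
  (including the empty product), so \<open>|S| \<le> n - 1\<close>.

  If \<open>|S| = m + n - 2\<close>, a shortest \<open>R \<subseteq> S\<close> with product in the coset of the product of \<open>S\<close> therefore has length
  \<open>m - 1\<close>, hence all its terms lie in one generating coset \<open>x\<^sup>a\<langle>y\<rangle>\<close>; a term of \<open>S\<close> in any other nontrivial coset
  would allow a shorter \<open>R\<close>. If exactly \<open>m - 1\<close> terms lie outside \<open>\<langle>y\<rangle>\<close>, the others form an extremal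
  zero-sum free sequence over a cyclic group. Otherwise there are at least \<open>2 m - 1\<close> of them, and any \<open>2 m - 1\<close>
  of these have at most \<open>m\<close> nontrivial products in \<open>\<langle>y\<rangle>\<close>, which must form one orbit under multiplication by \<open>s\<^sup>a\<close>. Splitting
  them into \<open>m - 1\<close> pairs of distinct terms shows that this is impossible for \<open>m \<ge> 3\<close>, and for \<open>m = 2\<close> it
  forces \<open>n = 3\<close>.
\<close>

section \<open>Zero-sum theory in abelian groups\<close>

text \<open>The induction replaces \<open>(A, B)\<close> by its Dyson transform \<open>(A \<union> (a + B), B \<inter> (A - a))\<close>.\<close>

lemma (in comm_group) scherk:
  assumes "finite A" "finite B" "A \<subseteq> carrier G" "B \<subseteq> carrier G" "\<one> \<in> A" "\<one> \<in> B"
    and "\<And>a b. a \<in> A \<Longrightarrow> b \<in> B \<Longrightarrow> a \<otimes> b = \<one> \<Longrightarrow> a = \<one> \<and> b = \<one>"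
  shows "card A + card B \<le> card (A <#> B) + 1"
  using assms
proof (induction "card B" arbitrary: A B rule: less_induct)
  case less
  have fin: "finite (A <#> B)"
    using less.prems(1,2) by (simp add: set_mult_def)
  show ?case
  proof (cases "B = {\<one>}")
    case True
    then have "A <#> B = A"
      using less.prems(3) by (force simp: set_mult_def)
    with True show ?thesis by simp
  next
    case False
    then obtain b where b: "b \<in> B" "b \<noteq> \<one>"
      using less.prems(6) by blast
    \<comment> \<open>If every translate of \<open>B\<close> by an element of \<open>A\<close>
      stayed in \<open>A\<close>, multiplication by \<open>b\<close> would permute \<open>A\<close>
      and hit the identity, although \<open>b\<close> is not the identity.\<close>
    have "\<exists>a\<in>A. \<not> (\<lambda>b. a \<otimes> b) ` B \<subseteq> A"
    proof (rule ccontr)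
      assume *: "\<not> ?thesis"
      then have "(\<lambda>a. a \<otimes> b) ` A \<subseteq> A" using b by blast
      moreover have "inj_on (\<lambda>a. a \<otimes> b) A"
        using less.prems(3,4) b(1) by (intro inj_onI) (meson right_cancel subsetD)
      ultimately have "(\<lambda>a. a \<otimes> b) ` A = A"
        using endo_inj_surj[OF less.prems(1)] by blast
      then obtain a where "a \<in> A" "a \<otimes> b = \<one>"
        using less.prems(5) by (metis imageE)
      with b less.prems(7) show False by blast
    qed
    then obtain a where a: "a \<in> A" "\<not> (\<lambda>b. a \<otimes> b) ` B \<subseteq> A" by blast
    have ac: "a \<in> carrier G" using a less.prems(3) by blast
    define A' where "A' = A \<union> (\<lambda>b. a \<otimes> b) ` B"
    define B' where "B' = {b \<in> B. a \<otimes> b \<in> A}"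
    have B': "B' \<subset> B" using a by (auto simp: B'_def)
    then have finB': "finite B'" using less.prems(2) finite_subset by blast
    have inj: "inj_on (\<lambda>b. a \<otimes> b) B"
      using less.prems(4) ac by (intro inj_onI) (metis Units_eq Units_l_cancel subsetD)
    have "A \<inter> (\<lambda>b. a \<otimes> b) ` B = (\<lambda>b. a \<otimes> b) ` B'"
      by (auto simp: B'_def)
    moreover have "card ((\<lambda>b. a \<otimes> b) ` B') = card B'"
      using inj B' by (meson card_image inj_on_subset psubset_imp_subset)
    ultimately have cards: "card A' + card B' = card A + card B"
      using card_Un_Int[of A "(\<lambda>b. a \<otimes> b) ` B"] less.prems(1,2) card_image[OF inj]
      by (simp add: A'_def)
    have swap: "(a \<otimes> b) \<otimes> b' = (a \<otimes> b') \<otimes> b" if "b \<in> B" "b' \<in> B" for b b'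
      using that ac less.prems(4) by (metis m_assoc m_comm subsetD)
    have sub: "A' <#> B' \<subseteq> A <#> B"
      using swap by (auto simp: A'_def B'_def set_mult_def)
    have "card A' + card B' \<le> card (A' <#> B') + 1"
    proof (rule less.hyps)
      show "card B' < card B" using B' less.prems(2) psubset_card_mono by blast
      show "finite A'" using less.prems(1,2) by (simp add: A'_def)
      show "A' \<subseteq> carrier G" using less.prems(3,4) ac by (auto simp: A'_def)
      show "\<one> \<in> B'" using a ac less.prems(6) by (simp add: B'_def)
      \<comment> \<open>Only \<open>u\<close> outside \<open>A\<close> needs work: if
        \<open>u = a b\<close>, regrouping gives (a v) b = 1 with a v in \<open>A\<close>, so b = 1
        and u = a lies in \<open>A\<close> after all.\<close>
      fix u v assume u: "u \<in> A'" and v: "v \<in> B'" and uv: "u \<otimes> v = \<one>"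
      show "u = \<one> \<and> v = \<one>"
      proof (cases "u \<in> A")
        case True
        with v uv less.prems(7) show ?thesis by (auto simp: B'_def)
      next
        case False
        then obtain b where bb: "b \<in> B" "u = a \<otimes> b" using u by (auto simp: A'_def)
        have vB: "v \<in> B" "a \<otimes> v \<in> A" using v by (auto simp: B'_def)
        have "(a \<otimes> v) \<otimes> b = \<one>" using uv bb swap vB by simp
        then have "b = \<one>" using less.prems(7) vB bb by blast
        then have "u = a" using bb ac by simp
        with a(1) False show ?thesis by simp
      qed
    qed (use less.prems B' finB' in \<open>auto simp: A'_def\<close>)
    with cards show ?thesis
      using card_mono[OF fin sub] by linarith
  qed
qed

section \<open>Extremal zero-sum free sequences over a cyclic group\<close>

text \<open>The weight \<open>f\<close> is a parameter because both components of a pair are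
  weighed: exponents of x modulo \<open>m\<close> and exponents of y modulo
  \<open>n\<close>.\<close>

definition zero_sum_free :: "('a \<Rightarrow> int) \<Rightarrow> nat \<Rightarrow> 'a multiset \<Rightarrow> bool" where
  "zero_sum_free f m R \<longleftrightarrow> (\<forall>T. T \<subseteq># R \<longrightarrow> T \<noteq> {#} \<longrightarrow> \<not> int m dvd (\<Sum>r\<in>#T. f r))"

text \<open>The residues of the prefix sums are pairwise distinct.\<close>

lemma zero_sum_free_size:
  assumes "m > 0" and zsf: "zero_sum_free f m R"
  shows "size R \<le> m - 1"
    and "size R = m - 1 \<Longrightarrow> r \<in># R \<Longrightarrow> r' \<in># R - {#r#} \<Longrightarrow> [f r = f r'] (mod int m)"
    and "size R = m - 1 \<Longrightarrow> r \<in># R \<Longrightarrow> coprime (f r) (int m)"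
proof -
  have free: "\<not> int m dvd (\<Sum>r\<in>#T. f r)" if "T \<subseteq># R" "T \<noteq> {#}" for T
    using zsf that by (simp add: zero_sum_free_def)
  define p where "p xs k = (\<Sum>r\<leftarrow>take k xs. f r) mod int m" for xs k
  have inj: "inj_on (p xs) {..length xs}" if xs: "mset xs = R" for xs
  proof -
    have "p xs j \<noteq> p xs k" if "j < k" "k \<le> length xs" for j k
    proof
      assume "p xs j = p xs k"
      moreover have "take k xs = take j xs @ take (k - j) (drop j xs)"
        using that by (metis le_add_diff_inverse less_imp_le take_add)
      then have "(\<Sum>r\<leftarrow>take k xs. f r) =
          (\<Sum>r\<leftarrow>take j xs. f r) + (\<Sum>r\<leftarrow>take (k - j) (drop j xs). f r)"
        by simp
      ultimately have "int m dvd (\<Sum>r\<leftarrow>take (k - j) (drop j xs). f r)"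
        unfolding p_def by (metis add_diff_cancel_left' mod_eq_dvd_iff)
      moreover have "mset (take (k - j) (drop j xs)) \<subseteq># R"
        unfolding xs[symmetric]
        by (metis append_take_drop_id mset_append mset_subset_eq_add_left
            mset_subset_eq_add_right subset_mset.trans)
      moreover have "take (k - j) (drop j xs) \<noteq> []" using that by simp
      ultimately show False
        using free[of "mset (take (k - j) (drop j xs))"]
        by (simp flip: sum_mset_sum_list)
    qed
    then show ?thesis
      by (intro inj_onI) (metis atMost_iff linorder_neqE_nat)
  qed
  have rng: "p xs ` {..length xs} \<subseteq> {0..<int m}" for xs
    using assms(1) by (auto simp: p_def)
  obtain xs0 where xs0: "mset xs0 = R" using ex_mset by blast
  have "card {..length xs0} \<le> card {0..<int m}"
    using inj[OF xs0] rng by (intro card_inj_on_le) auto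
  then show "size R \<le> m - 1"
    using xs0 by auto
  assume size: "size R = m - 1"
  have eq: "[f r = f r'] (mod int m)" if r: "r \<in># R" "r' \<in># R - {#r#}" for r r'
  proof -
    \<comment> \<open>With \<open>r\<close> and \<open>r'\<close> listed first, the \<open>m\<close>
      prefix sums fill all residues, so one of them equals \<open>f r'\<close>. Length 0 makes
      \<open>f r'\<close> vanish, length 1 is the claim, and a longer prefix becomes a zero sum once
      \<open>f r'\<close> is cancelled.\<close>
    obtain ys where ys: "mset ys = R - {#r#} - {#r'#}" using ex_mset by blast
    define xs where "xs = r # r' # ys"
    have xs: "mset xs = R" using r ys by (metis insert_DiffM mset.simps(2) xs_def)
    have len: "length xs = m - 1" using xs size by (metis size_mset)
    have "card (p xs ` {..length xs}) = card {0..<int m}"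
      using card_image[OF inj[OF xs]] len assms(1) by simp
    then have "p xs ` {..length xs} = {0..<int m}"
      using rng by (intro card_subset_eq) auto
    moreover have "f r' mod int m \<in> {0..<int m}" using assms(1) by simp
    ultimately obtain k where k: "k \<le> length xs" "p xs k = f r' mod int m"
      by (metis (no_types, lifting) atMost_iff imageE)
    have r': "r' \<in># R" using r by (meson in_diffD)
    consider "k = 0" | "k = 1" | j where "k = Suc (Suc j)"
      by (metis One_nat_def not0_implies_Suc)
    then show ?thesis
    proof cases
      case 1
      with k have "int m dvd f r'" by (simp add: p_def mod_0_imp_dvd)
      with free[of "{#r'#}"] r' show ?thesis by simp
    next
      case 2
      with k show ?thesis by (simp add: p_def xs_def cong_def)
    next
      case 3
      with k have "(f r + (f r' + (\<Sum>r\<leftarrow>take j ys. f r))) mod int m = f r' mod int m"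
        by (simp add: p_def xs_def)
      then have "int m dvd f r + (\<Sum>r\<leftarrow>take j ys. f r)"
        by (simp add: mod_eq_dvd_iff algebra_simps)
      moreover have "mset (r # take j ys) \<subseteq># R"
      proof -
        have "mset (take j ys) \<subseteq># mset ys"
          by (metis append_take_drop_id mset_append mset_subset_eq_add_left)
        then have "mset (r # take j ys) \<subseteq># mset (r # ys)" by simp
        also have "mset (r # ys) \<subseteq># mset xs" by (simp add: xs_def)
        finally show ?thesis using xs by simp
      qed
      ultimately show ?thesis
        using free[of "mset (r # take j ys)"] by (simp flip: sum_mset_sum_list)
    qed
  qed
  then show "r \<in># R \<Longrightarrow> r' \<in># R - {#r#} \<Longrightarrow> [f r = f r'] (mod int m)" for r r'
    by blast
  assume r: "r \<in># R"
  show "coprime (f r) (int m)"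
  proof (rule ccontr)
    assume nc: "\<not> coprime (f r) (int m)"
    define d where "d = gcd (f r) (int m)"
    have d: "d > 1" "d dvd f r" "d dvd int m"
      using nc assms(1) by (auto simp: d_def coprime_iff_gcd_eq_1 dest: order_antisym_conv)
        (metis gcd_pos_int less_le of_nat_0_less_iff less_irrefl int_one_le_iff_zero_less)
    \<comment> \<open>All weights are congruent to \<open>f r\<close>, a multiple of
      \<open>d\<close>, so \<open>m / d\<close> terms already sum to a multiple of \<open>m\<close>;
      that many are available because \<open>k < m\<close>.\<close>
    define k where "k = nat (int m div d)"
    have k: "int k * d = int m" using d by (simp add: k_def pos_imp_zdiv_nonneg_iff)
    then have "k < m" "k > 0" using d(1) assms(1)
      by (smt (verit) mult_less_cancel_left2 nat_int_comparison(2) of_nat_0_le_iff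
          zero_less_imp_eq_int mult_eq_0_iff of_nat_0_less_iff mult_le_cancel_left2)
         (use k assms(1) in \<open>auto intro: gr0I\<close>)
    obtain ys where ys: "mset ys = R" using ex_mset by blast
    define T where "T = mset (take k ys)"
    have T: "T \<subseteq># R" unfolding T_def ys[symmetric]
      by (metis append_take_drop_id mset_append mset_subset_eq_add_left)
    have sT: "size T = k" using \<open>k < m\<close> size ys by (auto simp: T_def)
    have "[f t = f r] (mod int m)" if "t \<in># T" for t
    proof (cases "t = r")
      case False
      moreover have "t \<in># R" using that T by (meson mset_subset_eqD)
      ultimately show ?thesis using eq[of t r] r by (metis insert_DiffM insert_noteq_member)
    qed simp
    then have "[(\<Sum>t\<in>#T. f t) = int (size T) * f r] (mod int m)"
    proof (induction T)
      case (add t T)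
      then have "[f t + (\<Sum>t\<in>#T. f t) = f r + int (size T) * f r] (mod int m)"
        by (intro cong_add) auto
      then show ?case by (simp add: algebra_simps)
    qed simp
    moreover have "int m dvd int k * f r"
      using d(2) k by (metis dvd_refl mult_dvd_mono)
    ultimately have "int m dvd (\<Sum>t\<in>#T. f t)"
      using sT by (simp add: cong_dvd_iff)
    moreover have "T \<noteq> {#}" using sT \<open>k > 0\<close> by auto
    ultimately show False using free T by blast
  qed
qed

section \<open>Products lying in the normal cyclic subgroup\<close>

text \<open>A pair \<open>(i, j)\<close> stands for \<open>x\<^sup>i y\<^sup>j\<close>; the condition \<open>s_unit\<close> says that \<open>x\<close> acts
  fixed-point-freely on \<open>\<langle>y\<rangle>\<close>.\<close>

locale frobenius_pairs =
  fixes m n :: nat and s :: int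
  assumes m_pos: "m > 0" and n_pos: "n > 0"
    and s_pow: "[s ^ m = 1] (mod int n)"
    and s_unit: "\<And>i. 0 < i \<Longrightarrow> i < m \<Longrightarrow> coprime (s ^ i - 1) (int n)"
begin

text \<open>The relation gives y^j x^k = x^k y^(j s^k). Nothing is reduced here: the first component
  stays a natural number so that it can serve as an exponent of \<open>s\<close>, and congruences
  enter only when products are compared.\<close>

definition pmul :: "nat \<times> int \<Rightarrow> nat \<times> int \<Rightarrow> nat \<times> int" where
  "pmul p q = (fst p + fst q, snd p * s ^ fst q + snd q)"

definition pprod :: "(nat \<times> int) list \<Rightarrow> nat \<times> int" where
  "pprod ps = foldr pmul ps (0, 0)"

definition deg :: "(nat \<times> int) multiset \<Rightarrow> nat" where
  "deg S = (\<Sum>p\<in>#S. fst p)"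

text \<open>The exponents of those products of subsequences of \<open>S\<close> that lie in \<open>\<langle>y\<rangle>\<close>, including the
  empty product.\<close>

definition ysums :: "(nat \<times> int) multiset \<Rightarrow> int set" where
  "ysums S = (\<lambda>ps. snd (pprod ps) mod int n) ` {ps. mset ps \<subseteq># S \<and> m dvd fst (pprod ps)}"

text \<open>Two divisibilities replace equality with the identity, and lists replace multisets
  because the order of the factors matters. The link to the group is
  \<open>product_one_free_iff\<close>.\<close>

definition pof :: "(nat \<times> int) multiset \<Rightarrow> bool" where
  "pof S \<longleftrightarrow> (\<forall>ps. mset ps \<subseteq># S \<longrightarrow> ps \<noteq> [] \<longrightarrow> m dvd fst (pprod ps) \<longrightarrow> \<not> int n dvd snd (pprod ps))"

lemma pprod_simps [simp]:
  "pprod [] = (0, 0)"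
  "pprod (p # ps) = (fst p + fst (pprod ps), snd p * s ^ fst (pprod ps) + snd (pprod ps))"
  by (simp_all add: pprod_def pmul_def)

lemma fst_pprod: "fst (pprod ps) = deg (mset ps)"
  by (induction ps) (auto simp: deg_def)

lemma deg_add [simp]: "deg (S + T) = deg S + deg T"
  and deg_empty [simp]: "deg {#} = 0"
  and deg_add_mset [simp]: "deg (add_mset p S) = fst p + deg S"
  by (simp_all add: deg_def)

lemma pprod_append:
  "pprod (ps @ qs) =
    (fst (pprod ps) + fst (pprod qs), snd (pprod ps) * s ^ fst (pprod qs) + snd (pprod qs))"
  by (induction ps) (auto simp: algebra_simps power_add)

lemma s_pow_dvd: "m dvd k \<Longrightarrow> [s ^ k = 1] (mod int n)"
  using cong_pow[OF s_pow] by (auto simp: power_mult elim!: dvdE)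

lemma s_unit_dvd:
  assumes "\<not> m dvd k"
  shows "coprime (s ^ k - 1) (int n)"
proof -
  have "[s ^ (m * (k div m)) * s ^ (k mod m) - 1 = 1 * s ^ (k mod m) - 1] (mod int n)"
    by (intro cong_diff cong_mult s_pow_dvd) auto
  then have "[s ^ k - 1 = s ^ (k mod m) - 1] (mod int n)"
    by (simp flip: power_add)
  moreover have "coprime (s ^ (k mod m) - 1) (int n)"
    using assms m_pos by (intro s_unit) (auto simp: dvd_eq_mod_eq_0)
  ultimately show ?thesis
    using cong_imp_coprime cong_sym by blast
qed

lemma coprime_s: "coprime s (int n)"
proof -
  have "coprime (s ^ m) (int n)"
    using cong_imp_coprime[OF cong_sym[OF s_pow]] by simp
  then show ?thesis using m_pos by simp
qed

text \<open>Both \<open>s ^ j\<close> and \<open>s ^ k - 1\<close> are units modulo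
  \<open>n\<close>. This fixed-point-freeness makes the orbits under multiplication by
  \<open>s\<close> have full length \<open>m\<close> away from 0.\<close>

lemma dvd_diff_power:
  assumes "int n dvd h * s ^ j - h * s ^ (j + k)" "\<not> m dvd k"
  shows "int n dvd h"
proof -
  have "h * s ^ j - h * s ^ (j + k) = - (h * (s ^ j * (s ^ k - 1)))"
    by (simp add: algebra_simps power_add)
  moreover have "coprime (s ^ j * (s ^ k - 1)) (int n)"
    using coprime_s s_unit_dvd[OF assms(2)] by simp
  ultimately show ?thesis
    using assms(1) by (simp add: coprime_commute coprime_dvd_mult_left_iff)
qed

lemma pprod_append_cong:
  assumes "m dvd fst (pprod qs)"
  shows "[snd (pprod (ps @ qs)) = snd (pprod ps) + snd (pprod qs)] (mod int n)"
proof -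
  have "[snd (pprod ps) * s ^ fst (pprod qs) + snd (pprod qs) = snd (pprod ps) * 1 + snd (pprod qs)] (mod int n)"
    by (intro cong_add cong_mult s_pow_dvd assms) auto
  then show ?thesis by (simp add: pprod_append)
qed

lemma pof_mono: "pof S \<Longrightarrow> T \<subseteq># S \<Longrightarrow> pof T"
  unfolding pof_def by (meson subset_mset.trans)

lemma ysums_mono: "T \<subseteq># S \<Longrightarrow> ysums T \<subseteq> ysums S"
  unfolding ysums_def by (blast intro: subset_mset.trans)

lemma ysums_bounded: "ysums S \<subseteq> {0..<int n}"
  using n_pos by (auto simp: ysums_def)

lemma finite_ysums [simp]: "finite (ysums S)"
  using ysums_bounded finite_subset by blast

lemma card_ysums_le: "card (ysums S) \<le> n"
  using card_mono[OF _ ysums_bounded] by simp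

lemma ysumsI: "mset ps \<subseteq># S \<Longrightarrow> m dvd fst (pprod ps) \<Longrightarrow> snd (pprod ps) mod int n \<in> ysums S"
  unfolding ysums_def by blast

lemma zero_in_ysums [simp]: "0 \<in> ysums S"
  using ysumsI[of "[]" S] by simp

section \<open>Counting the products in the normal subgroup\<close>

text \<open>Concatenating two products in the normal subgroup adds their exponents, so the sumset
  lies in \<open>ysums (S + T)\<close>. A nontrivial representation of 0 would be a nonempty product
  equal to 1, so \<open>pof\<close> supplies the hypothesis of \<open>scherk\<close>.\<close>

lemma card_ysums_add:
  assumes "pof (S + T)"
  shows "card (ysums S) + card (ysums T) \<le> card (ysums (S + T)) + 1"
proof -
  interpret Z: comm_group "integer_mod_group n"
    by (rule abelian_integer_mod_group)
  have Z: "carrier (integer_mod_group n) = {0..<int n}" "\<one>\<^bsub>integer_mod_group n\<^esub> = 0"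
    "a \<otimes>\<^bsub>integer_mod_group n\<^esub> b = (a + b) mod int n" for a b
    using n_pos by (auto simp: carrier_integer_mod_group integer_mod_group_def)
  have add: "mset (ps @ qs) \<subseteq># S + T \<and> m dvd fst (pprod (ps @ qs)) \<and>
      (snd (pprod ps) mod int n + snd (pprod qs) mod int n) mod int n = snd (pprod (ps @ qs)) mod int n"
    if "mset ps \<subseteq># S" "m dvd fst (pprod ps)" "mset qs \<subseteq># T" "m dvd fst (pprod qs)" for ps qs
    using that pprod_append_cong[of qs ps]
    by (auto simp: pprod_append mod_add_eq cong_def subset_mset.add_mono)
  have "card (ysums S) + card (ysums T) \<le> card (ysums S <#>\<^bsub>integer_mod_group n\<^esub> ysums T) + 1"
  proof (rule Z.scherk)
    fix a b assume "a \<in> ysums S" "b \<in> ysums T" and ab: "a \<otimes>\<^bsub>integer_mod_group n\<^esub> b = \<one>\<^bsub>integer_mod_group n\<^esub>"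
    then obtain ps qs where ps: "mset ps \<subseteq># S" "m dvd fst (pprod ps)" "a = snd (pprod ps) mod int n"
      and qs: "mset qs \<subseteq># T" "m dvd fst (pprod qs)" "b = snd (pprod qs) mod int n"
      unfolding ysums_def by blast
    then have "ps @ qs = []"
      using ab add[OF ps(1,2) qs(1,2)] assms unfolding pof_def Z by (metis mod_0_imp_dvd)
    then show "a = \<one>\<^bsub>integer_mod_group n\<^esub> \<and> b = \<one>\<^bsub>integer_mod_group n\<^esub>"
      using ps qs Z by simp
  qed (use ysums_bounded in \<open>auto simp: Z\<close>)
  also have "ysums S <#>\<^bsub>integer_mod_group n\<^esub> ysums T \<subseteq> ysums (S + T)"
  proof
    fix c assume "c \<in> ysums S <#>\<^bsub>integer_mod_group n\<^esub> ysums T"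
    then obtain ps qs where ps: "mset ps \<subseteq># S" "m dvd fst (pprod ps)"
      and qs: "mset qs \<subseteq># T" "m dvd fst (pprod qs)"
      and "c = (snd (pprod ps) mod int n + snd (pprod qs) mod int n) mod int n"
      unfolding set_mult_def ysums_def Z by blast
    with add[OF ps qs] show "c \<in> ysums (S + T)"
      by (metis ysumsI)
  qed
  then have "card (ysums S <#>\<^bsub>integer_mod_group n\<^esub> ysums T) \<le> card (ysums (S + T))"
    by (rule card_mono[OF finite_ysums])
  finally show ?thesis by simp
qed

text \<open>Rotating a product in \<open>\<langle>y\<rangle>\<close> multiplies its exponent by a power of \<open>s\<close>; by minimality
  these powers are pairwise incongruent.\<close>

lemma card_ysums_minimal:
  assumes "pof T" "m dvd deg T"
    and min: "\<And>U. U \<subset># T \<Longrightarrow> U \<noteq> {#} \<Longrightarrow> \<not> m dvd deg U"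
  shows "size T + 1 \<le> card (ysums T)"
proof -
  obtain ps where ps: "mset ps = T" using ex_mset by blast
  define h where "h = snd (pprod ps)"
  define e where "e k = deg (mset (take k ps))" for k
  define r where "r k = snd (pprod (drop k ps @ take k ps)) mod int n" for k
  have r: "[snd (pprod (drop k ps @ take k ps)) = h * s ^ e k] (mod int n)" for k
  proof -
    have app: "pprod ps = pprod (take k ps @ drop k ps)" by simp
    \<comment> \<open>The total degree is a multiple of \<open>m\<close>, so the moved prefix may be
      multiplied by \<open>s\<close> to the total degree; then \<open>s ^ e k\<close> factors out of
      the rotated exponent.\<close>
    have "m dvd e k + deg (mset (drop k ps))"
      using assms(2) unfolding e_def ps[symmetric]
      by (metis append_take_drop_id deg_add mset_append)
    then have "[snd (pprod (drop k ps)) * s ^ e k + snd (pprod (take k ps)) * 1 =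
      snd (pprod (drop k ps)) * s ^ e k + snd (pprod (take k ps)) * s ^ (e k + deg (mset (drop k ps)))] (mod int n)"
      by (intro cong_add cong_mult cong_sym[OF s_pow_dvd]) auto
    also have "snd (pprod (drop k ps)) * s ^ e k + snd (pprod (take k ps)) * s ^ (e k + deg (mset (drop k ps)))
        = h * s ^ e k"
      unfolding h_def app pprod_append by (simp add: fst_pprod algebra_simps power_add)
    finally show ?thesis
      by (simp add: pprod_append fst_pprod e_def)
  qed
  have mset_rot: "mset (drop k ps @ take k ps) = T" for k
    by (metis append_take_drop_id mset_append ps union_commute)
  have nz: "r k \<noteq> 0" if "T \<noteq> {#}" for k
  proof
    assume "r k = 0"
    moreover have "drop k ps @ take k ps \<noteq> []"
      using that mset_rot[of k] by (metis mset.simps(1))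
    moreover have "m dvd fst (pprod (drop k ps @ take k ps))"
      using assms(2) by (simp only: fst_pprod mset_rot)
    ultimately show False
      using assms(1) mset_rot[of k] unfolding pof_def r_def by (metis mod_0_imp_dvd subset_mset.order_refl)
  qed
  have "r j \<noteq> r k" if jk: "j < k" "k < length ps" for j k
  proof
    assume eq: "r j = r k"
    \<comment> \<open>\<open>U\<close> is the block by which the two rotations differ. It misses the
      last term, as \<open>k < length ps\<close>, hence is a proper subsequence and its degree is
      not a multiple of \<open>m\<close>.\<close>
    define U where "U = mset (take (k - j) (drop j ps))"
    have tk: "take k ps = take j ps @ take (k - j) (drop j ps)"
      using jk by (metis le_add_diff_inverse less_imp_le take_add)
    have ek: "e k = e j + deg U" by (simp add: e_def U_def tk)
    have "T = mset (take j ps) + U + mset (drop k ps)"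
      unfolding U_def ps[symmetric] by (metis append_take_drop_id mset_append tk)
    then have T: "T = U + (mset (take j ps) + mset (drop k ps))" by simp
    moreover have "mset (drop k ps) \<noteq> {#}" using jk by simp
    ultimately have "U \<subset># T"
      by (metis empty_eq_union mset_subset_eq_add_left subset_mset.less_le add_cancel_right_right)
    moreover have "U \<noteq> {#}" using jk by (simp add: U_def)
    ultimately have "\<not> m dvd deg U" using min by blast
    moreover have "int n dvd h * s ^ e j - h * s ^ (e j + deg U)"
      using eq r[of j] r[of k] unfolding r_def ek cong_def by (metis mod_eq_dvd_iff)
    ultimately have "int n dvd h" using dvd_diff_power by blast
    moreover have "T \<noteq> {#}" using jk ps by auto
    ultimately show False
      using nz[of 0] r[of 0] by (simp add: r_def h_def)
  qed
  then have inj: "inj_on r {..<length ps}"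
    by (intro inj_onI) (metis lessThan_iff linorder_neqE_nat)
  have sub: "insert 0 (r ` {..<length ps}) \<subseteq> ysums T"
  proof -
    have "r k \<in> ysums T" for k
      unfolding r_def using mset_rot[of k] assms(2) by (intro ysumsI) (auto simp: fst_pprod simp del: mset_append)
    then show ?thesis by auto
  qed
  have "card (insert 0 (r ` {..<length ps})) = size T + 1"
  proof -
    have "0 \<notin> r ` {..<length ps}" using nz ps by fastforce
    then show ?thesis using card_image[OF inj] ps by (auto simp flip: size_mset)
  qed
  with card_mono[OF finite_ysums sub] show ?thesis by simp
qed

text \<open>Split off a smallest nonempty subsequence of degree divisible by \<open>m\<close>;
  \<open>card_ysums_minimal\<close> counts its products, induction counts those of the rest, and
  \<open>card_ysums_add\<close> combines them.\<close>

lemma card_ysums_ge: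
  assumes "pof S" "m dvd deg S"
  shows "size S + 1 \<le> card (ysums S)"
  using assms
proof (induction "size S" arbitrary: S rule: less_induct)
  case less
  show ?case
  proof (cases "S = {#}")
    case True
    have "card {0 :: int} \<le> card (ysums S)" by (rule card_mono) auto
    with True show ?thesis by simp
  next
    case False
    let ?P = "\<lambda>T. T \<subseteq># S \<and> T \<noteq> {#} \<and> m dvd deg T"
    obtain T where T: "?P T" and min: "\<And>U. ?P U \<Longrightarrow> size T \<le> size U"
      using ex_has_least_nat[of ?P S size] False less.prems by blast
    have "size T + 1 \<le> card (ysums T)"
    proof (rule card_ysums_minimal)
      show "pof T" using less.prems T pof_mono by blast
      show "\<not> m dvd deg U" if "U \<subset># T" "U \<noteq> {#}" for U
        using min[of U] that T mset_subset_size[of U T]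
        by (meson leD subset_mset.trans subset_mset.less_imp_le)
    qed (use T in auto)
    moreover have eq: "S = (S - T) + T" using T by simp
    moreover have "size (S - T) + 1 \<le> card (ysums (S - T))"
    proof (rule less.hyps)
      show "size (S - T) < size S" using T by (metis diff_less nonempty_has_size size_Diff_submset size_mset_mono less_le_trans)
      show "pof (S - T)" using less.prems(1) pof_mono diff_subset_eq_self by blast
      show "m dvd deg (S - T)" using less.prems(2) T eq by (metis deg_add dvd_add_left_iff)
    qed
    moreover have "card (ysums (S - T)) + card (ysums T) \<le> card (ysums S) + 1"
      using card_ysums_add[of "S - T" T] less.prems(1) eq by simp
    moreover have "size S = size (S - T) + size T" using eq by (metis size_union)
    ultimately show ?thesis by linarith
  qed
qed

lemma size_le_of_deg_dvd: "pof S \<Longrightarrow> m dvd deg S \<Longrightarrow> size S + 1 \<le> n"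
  using card_ysums_ge card_ysums_le order_trans by blast

text \<open>The complement of \<open>T\<close> already accounts for many of the \<open>n\<close>
  exponents. This is the source of every upper bound on the number of products of a small
  subsequence.\<close>

lemma card_ysums_complement:
  assumes "pof S" "T \<subseteq># S" "m dvd deg (S - T)"
  shows "card (ysums T) + size (S - T) \<le> n"
proof -
  have "card (ysums T) + card (ysums (S - T)) \<le> card (ysums (T + (S - T))) + 1"
    using assms by (intro card_ysums_add) simp
  moreover have "size (S - T) + 1 \<le> card (ysums (S - T))"
    using assms pof_mono[OF assms(1)] by (intro card_ysums_ge) auto
  ultimately show ?thesis using card_ysums_le[of "T + (S - T)"] by linarith
qed

section \<open>The length bound and the cosets of an extremal sequence\<close>

lemma deg_int: "(\<Sum>p\<in>#S. int (fst p)) = int (deg S)"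
  by (induction S) auto

text \<open>Removing a shortest subsequence whose product lies in the same coset of \<open>\<langle>y\<rangle>\<close> as that
  of the whole sequence leaves at most \<open>n - 1\<close> terms.\<close>

lemma minimal_remainder:
  obtains R where "R \<subseteq># S" "m dvd deg (S - R)"
    and "\<And>R'. R' \<subseteq># S \<Longrightarrow> m dvd deg (S - R') \<Longrightarrow> size R \<le> size R'"
    and "zero_sum_free (\<lambda>p. int (fst p)) m R"
proof -
  let ?P = "\<lambda>R. R \<subseteq># S \<and> m dvd deg (S - R)"
  obtain R where R: "?P R" and min: "\<And>R'. ?P R' \<Longrightarrow> size R \<le> size R'"
    using ex_has_least_nat[of ?P S size] by auto
  have "\<not> int m dvd (\<Sum>p\<in>#T. int (fst p))" if T: "T \<subseteq># R" "T \<noteq> {#}" for T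
  proof
    assume *: "int m dvd (\<Sum>p\<in>#T. int (fst p))"
    \<comment> \<open>A zero sum \<open>T\<close> inside \<open>R\<close> could be moved to the
      complement, leaving the shorter remainder \<open>R - T\<close>.\<close>
    have "S - (R - T) = (S - R) + T"
      using T R by (metis subset_mset.add_diff_assoc2 subset_mset.diff_diff_right)
    then have "m dvd deg (S - (R - T))"
      using * R by (simp only: deg_add deg_int int_dvd_int_iff dvd_add)
    moreover have "R - T \<subseteq># S"
      using R by (meson diff_subset_eq_self subset_mset.trans)
    ultimately have "?P (R - T)" by blast
    then have "size R \<le> size (R - T)" by (rule min)
    moreover have "size (R - T) < size R"
      using T by (metis diff_less nonempty_has_size size_Diff_submset size_mset_mono less_le_trans)
    ultimately show False by simp
  qed
  then have "zero_sum_free (\<lambda>p. int (fst p)) m R" by (simp add: zero_sum_free_def)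
  with R min that[of R] show ?thesis by blast
qed

lemma pof_size_le:
  assumes "pof S"
  shows "size S \<le> m + n - 2"
proof -
  obtain R where R: "R \<subseteq># S" "m dvd deg (S - R)"
    and free: "zero_sum_free (\<lambda>p. int (fst p)) m R"
    using minimal_remainder[of S] by metis
  have "size R \<le> m - 1" using zero_sum_free_size(1)[OF m_pos free] by blast
  moreover have "size (S - R) + 1 \<le> n"
    using R assms pof_mono by (intro size_le_of_deg_dvd) auto
  moreover have "size S = size R + size (S - R)"
    using R by (metis size_union subset_mset.add_diff_inverse)
  ultimately show ?thesis using m_pos by linarith
qed

text \<open>Equality in both length bounds makes the remainder \<open>R\<close> extremal zero-sum
  free modulo \<open>m\<close>, so its terms share one first component \<open>a\<close>, a unit. A
  term in a further nontrivial coset would replace several terms of \<open>R\<close>, against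
  minimality. The last claim compares the degree of \<open>S\<close> with (m - 1) a modulo
  \<open>m\<close>.\<close>

lemma coset_structure:
  assumes S: "pof S" "size S = m + n - 2" and bnd: "\<And>p. p \<in># S \<Longrightarrow> fst p < m" and m: "m \<ge> 2"
  obtains a where "coprime a m" "0 < a" "a < m" "\<And>p. p \<in># S \<Longrightarrow> fst p = 0 \<or> fst p = a"
    "m dvd size (filter_mset (\<lambda>p. fst p = a) S) + 1"
proof -
  obtain R where R: "R \<subseteq># S" "m dvd deg (S - R)"
    and min: "\<And>R'. R' \<subseteq># S \<Longrightarrow> m dvd deg (S - R') \<Longrightarrow> size R \<le> size R'"
    and free: "zero_sum_free (\<lambda>p. int (fst p)) m R"
    using minimal_remainder[of S] by metis
  note zs = zero_sum_free_size[OF m_pos free]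
  have "size R \<le> m - 1" using zs(1) by blast
  moreover have "size (S - R) + 1 \<le> n"
    using R S pof_mono by (intro size_le_of_deg_dvd) auto
  moreover have "size S = size R + size (S - R)"
    using R by (metis size_union subset_mset.add_diff_inverse)
  ultimately have sR: "size R = m - 1" using m_pos S(2) by linarith
  then have "R \<noteq> {#}" using m by auto
  then obtain r where r: "r \<in># R" by blast
  define a where "a = fst r"
  have cop: "coprime a m" using zs(3)[OF sR r] by (simp add: a_def)
  have am: "a < m" using bnd mset_subset_eqD[OF R(1) r] by (simp add: a_def)
  have a0: "a > 0" using cop m by (auto intro: gr0I)
  have Ra: "fst p = a" if "p \<in># R" for p
  proof (cases "p = r")
    case False
    then have "p \<in># R - {#r#}" using that r by (metis insert_DiffM insert_noteq_member)
    then have "[int a = int (fst p)] (mod int m)" using zs(2)[OF sR r] by (simp add: a_def)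
    moreover have "fst p < m" using bnd mset_subset_eqD[OF R(1) that] .
    ultimately show ?thesis using am by (simp add: cong_int_iff cong_def)
  qed (simp add: a_def)
  have deg_const: "deg T = size T * a" if "\<And>p. p \<in># T \<Longrightarrow> fst p = a" for T
    using that by (induction T) auto
  have dS: "[deg S = deg T] (mod m)" if "T \<subseteq># S" "m dvd deg (S - T)" for T
  proof -
    have "deg S = deg T + deg (S - T)" using that by (metis deg_add subset_mset.add_diff_inverse)
    then show ?thesis using that(2) by (simp add: cong_def mod_eq_0_iff_dvd mod_add_right_eq[symmetric] del: mod_add_right_eq)
  qed
  have cos: "fst p = 0 \<or> fst p = a" if p: "p \<in># S" for p
  proof (rule ccontr)
    assume np: "\<not> ?thesis"
    then have "p \<notin># R" using Ra by blast
    \<comment> \<open>With \<open>v\<close> inverse to \<open>a\<close>, the coset of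
      \<open>p\<close> is that of \<open>t\<close> terms of \<open>R\<close>; the excluded cosets
      are exactly \<open>t = 0\<close> and \<open>t = 1\<close>.\<close>
    obtain v where "[a * v = Suc 0] (mod m)" using cong_solve_coprime_nat[OF cop] by blast
    then have u: "[a * v * fst p = Suc 0 * fst p] (mod m)" by (rule cong_scalar_right)
    define t where "t = (v * fst p) mod m"
    have t: "[a * t = fst p] (mod m)" "t < m"
      using u m_pos by (simp_all add: t_def cong_def mod_mult_right_eq mult.assoc)
    have "t \<noteq> 0"
    proof
      assume "t = 0"
      then have "m dvd fst p" using t(1) by (metis cong_0_iff cong_sym mult_0_right)
      with bnd[OF p] np show False using nat_dvd_not_less by blast
    qed
    moreover have "t \<noteq> 1"
    proof
      assume "t = 1"
      then have "a = fst p" using t(1) am bnd[OF p] by (simp add: cong_less_modulus_unique_nat)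
      with np show False by simp
    qed
    ultimately have t2: "t \<ge> 2" by linarith
    obtain ps where ps: "mset ps = R" using ex_mset by blast
    \<comment> \<open>Trading \<open>t\<close> terms of \<open>R\<close> for \<open>p\<close> alone
      keeps the degree modulo \<open>m\<close> and leaves \<open>m - t\<close> terms, fewer than the
      \<open>m - 1\<close> terms of \<open>R\<close>.\<close>
    define U where "U = mset (take (m - 1 - t) ps)"
    have U: "U \<subseteq># R" unfolding U_def ps[symmetric]
      by (metis append_take_drop_id mset_append mset_subset_eq_add_left)
    have sU: "size U = m - 1 - t" using sR ps by (auto simp: U_def)
    have pU: "add_mset p U \<subseteq># S"
    proof -
      have "add_mset p R \<subseteq># S"
      proof (rule mset_subset_eqI)
        fix q
        show "count (add_mset p R) q \<le> count S q"
          using R(1) p \<open>p \<notin># R\<close>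
          by (cases "q = p") (simp_all add: mset_subset_eq_count not_in_iff Suc_le_eq)
      qed
      then show ?thesis using U by (meson mset_subset_eq_add_mset_cancel subset_mset.trans)
    qed
    have "deg U = (m - 1 - t) * a" using deg_const[of U] Ra U sU by (metis mset_subset_eqD)
    then have "[deg (add_mset p U) = a * t + (m - 1 - t) * a] (mod m)"
      using cong_add[OF cong_sym[OF t(1)] cong_refl] by simp
    also have "a * t + (m - 1 - t) * a = size R * a"
      using t(2) sR by (simp flip: distrib_right add: mult.commute[of a])
    also have "\<dots> = deg R" using deg_const[of R] Ra by simp
    also have "[deg R = deg S] (mod m)" using dS[OF R] by (rule cong_sym)
    finally have "[deg (add_mset p U) = deg S] (mod m)" .
    moreover have "deg S = deg (add_mset p U) + deg (S - add_mset p U)"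
      using pU by (metis deg_add subset_mset.add_diff_inverse)
    ultimately have "[deg (add_mset p U) + deg (S - add_mset p U) = deg (add_mset p U) + 0] (mod m)"
      by (metis add_0_right cong_sym)
    then have "m dvd deg (S - add_mset p U)"
      by (simp only: cong_add_lcancel_nat cong_0_iff)
    then have "size R \<le> size (add_mset p U)" using min pU by blast
    then show False using sR sU t2 t(2) by simp
  qed
  let ?M = "filter_mset (\<lambda>p. fst p = a) S" and ?K = "filter_mset (\<lambda>p. fst p \<noteq> a) S"
  have "fst p = 0" if "p \<in># ?K" for p using cos[of p] that by simp
  then have "deg ?K = 0" by (simp add: deg_def)
  moreover have "deg ?M = size ?M * a" by (rule deg_const) auto
  moreover have "deg S = deg ?M + deg ?K" by (metis deg_add multiset_partition)
  ultimately have "[size ?M * a = (m - 1) * a] (mod m)"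
    using dS[OF R] deg_const[of R] Ra sR by simp
  then have "[size ?M * a + a = (m - 1) * a + a] (mod m)" by (rule cong_add) simp
  moreover have "(m - 1) * a + a = m * a" using m by (cases m) auto
  ultimately have "[size ?M * a + a = m * a] (mod m)" by simp
  then have "m dvd size ?M * a + a" using cong_dvd_iff by fastforce
  then have "m dvd (size ?M + 1) * a" by (simp add: add.commute)
  then have "m dvd size ?M + 1" using cop by (metis coprime_commute coprime_dvd_mult_left_iff)
  with that cop a0 am cos show ?thesis by blast
qed

end

section \<open>Products of terms from a single coset\<close>

context frobenius_pairs
begin

text \<open>The sum times the unit \<open>s - 1\<close> is \<open>s ^ m - 1\<close>. It is used to
  see that \<open>m\<close> equal terms of a generating coset multiply to 1.\<close>

lemma geometric_dvd:
  assumes "m \<ge> 2"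
  shows "int n dvd (\<Sum>k<m. s ^ k)"
proof -
  have "int n dvd (s - 1) * (\<Sum>k<m. s ^ k)"
    using s_pow by (simp add: cong_iff_dvd_diff power_diff_1_eq)
  moreover have "coprime (s - 1) (int n)"
    using s_unit[of 1] assms by simp
  ultimately show ?thesis
    by (simp add: coprime_commute coprime_dvd_mult_right_iff)
qed

text \<open>For \<open>k < m\<close> the factor \<open>s ^ k\<close> is attached to the term \<open>b (g k)\<close>, so these are the
  exponents of the products of \<open>m\<close> terms taken from one coset of \<open>\<langle>y\<rangle>\<close>.\<close>

definition arrangement :: "(nat \<Rightarrow> int) \<Rightarrow> (nat \<Rightarrow> nat) \<Rightarrow> int" where
  "arrangement b g = (\<Sum>k<m. b (g k) * s ^ k)"

text \<open>The cyclic shift raises each power of \<open>s\<close> by one; the term that carried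
  \<open>s ^ (m - 1)\<close> returns to position 0 because \<open>s ^ m\<close> is 1 modulo
  \<open>n\<close>.\<close>

lemma arrangement_rotate:
  assumes "inj_on g {..<m}"
  obtains g' where "inj_on g' {..<m}" "g' ` {..<m} = g ` {..<m}"
    "[arrangement b g' = arrangement b g * s] (mod int n)"
proof -
  obtain l where l: "m = Suc l" using m_pos by (cases m) auto
  define g' where "g' k = (case k of 0 \<Rightarrow> g l | Suc k \<Rightarrow> g k)" for k
  have img: "g' ` {..<m} = g ` {..<m}"
  proof -
    have "g' ` insert 0 (Suc ` {..<l}) = g ` insert l {..<l}"
      by (simp add: g'_def image_image)
    then show ?thesis by (simp only: l lessThan_Suc flip: lessThan_Suc_eq_insert_0)
  qed
  then have "card (g' ` {..<m}) = card {..<m}" using card_image[OF assms] by simp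
  then have inj: "inj_on g' {..<m}" by (simp add: eq_card_imp_inj_on)
  have arr: "arrangement b f = (\<Sum>k<Suc l. b (f k) * s ^ k)" for f
    unfolding arrangement_def by (simp only: l)
  have "arrangement b g' = b (g l) * 1 + (\<Sum>k<l. b (g k) * s ^ k) * s"
    unfolding arr sum.lessThan_Suc_shift
    by (simp add: g'_def sum_distrib_left sum_distrib_right mult_ac)
  also have "[b (g l) * 1 + (\<Sum>k<l. b (g k) * s ^ k) * s =
      b (g l) * s ^ m + (\<Sum>k<l. b (g k) * s ^ k) * s] (mod int n)"
    by (intro cong_add cong_mult cong_sym[OF s_pow]) auto
  also have "b (g l) * s ^ m + (\<Sum>k<l. b (g k) * s ^ k) * s = arrangement b g * s"
    unfolding arr by (simp add: l algebra_simps)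
  finally show ?thesis using that inj img by blast
qed

text \<open>Rotations of a single arrangement yield \<open>m\<close> distinct values, and
  \<open>Q\<close> has no room for more.\<close>

lemma orbit_of_arrangements:
  assumes "finite Q" "card Q \<le> m" "0 \<notin> Q"
    and vals: "\<And>g. inj_on g {..<m} \<Longrightarrow> g ` {..<m} \<subseteq> I \<Longrightarrow> arrangement b g mod int n \<in> Q"
    and g: "inj_on g {..<m}" "g ` {..<m} \<subseteq> I"
  shows "Q = (\<lambda>i. arrangement b g * s ^ i mod int n) ` {..<m}"
proof -
  let ?h = "arrangement b g"
  have "\<exists>g'. inj_on g' {..<m} \<and> g' ` {..<m} \<subseteq> I \<and> [arrangement b g' = ?h * s ^ i] (mod int n)" for i
  proof (induction i)
    case 0
    then show ?case using g by auto
  next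
    case (Suc i)
    then obtain g' where g': "inj_on g' {..<m}" "g' ` {..<m} \<subseteq> I" "[arrangement b g' = ?h * s ^ i] (mod int n)"
      by blast
    obtain g'' where "inj_on g'' {..<m}" "g'' ` {..<m} = g' ` {..<m}"
      "[arrangement b g'' = arrangement b g' * s] (mod int n)"
      using arrangement_rotate[OF g'(1)] by metis
    moreover have "[arrangement b g' * s = ?h * s ^ i * s] (mod int n)"
      using g'(3) by (rule cong_scalar_right)
    ultimately show ?case
      using g'(2) cong_trans by (metis mult.assoc power_Suc2)
  qed
  then have sub: "(\<lambda>i. ?h * s ^ i mod int n) ` {..<m} \<subseteq> Q"
    using vals unfolding cong_def by (metis (no_types, lifting) image_subsetI)
  have h: "\<not> int n dvd ?h" using vals[OF g] assms(3) by auto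
  have "?h * s ^ i mod int n \<noteq> ?h * s ^ j mod int n" if "i < j" "j < m" for i j
  proof
    assume "?h * s ^ i mod int n = ?h * s ^ j mod int n"
    then have "int n dvd ?h * s ^ i - ?h * s ^ (i + (j - i))"
      using that by (simp add: mod_eq_dvd_iff)
    moreover have "\<not> m dvd j - i" using that by (simp add: nat_dvd_not_less)
    ultimately show False using dvd_diff_power h by blast
  qed
  then have "inj_on (\<lambda>i. ?h * s ^ i mod int n) {..<m}"
    by (intro inj_onI) (metis lessThan_iff linorder_neqE_nat)
  then have "card ((\<lambda>i. ?h * s ^ i mod int n) ` {..<m}) = m" by (simp add: card_image)
  then show ?thesis using card_seteq[OF assms(1) sub] assms(2) by simp
qed

text \<open>Two orbit points differ by \<open>h\<close> times a unit. If \<open>d\<close> were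
  nonzero it would be such a difference, so adding multiples of \<open>d\<close> to \<open>v\<close>
  would reach every multiple of \<open>h\<close>, including 0.\<close>

lemma orbit_translate:
  assumes orb: "Q = (\<lambda>i. h * s ^ i mod int n) ` {..<m}" and "0 \<notin> Q"
    and v: "\<And>k. (v + int k * d) mod int n \<in> Q"
  shows "int n dvd d"
proof (rule ccontr)
  assume nd: "\<not> int n dvd d"
  obtain i where i: "i < m" "v mod int n = h * s ^ i mod int n"
    using v[of 0] by (auto simp: orb)
  obtain j where j: "j < m" "(v + d) mod int n = h * s ^ j mod int n"
    using v[of 1] by (auto simp: orb)
  have d: "[h * s ^ j - h * s ^ i = d] (mod int n)"
  proof -
    have "[h * s ^ j - h * s ^ i = (v + d) - v] (mod int n)"
      using i j by (intro cong_diff) (simp_all add: cong_def)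
    then show ?thesis by simp
  qed
  obtain u where "coprime u (int n)" "[h * u = d] (mod int n)"
  proof -
    consider "i = j" | "i < j" | "j < i" by linarith
    then show ?thesis
    proof cases
      case 1
      with d nd show ?thesis by (metis cancel_comm_monoid_add_class.diff_cancel cong_0_iff cong_sym)
    next
      case 2
      then have "\<not> m dvd j - i" using j by (simp add: nat_dvd_not_less)
      then have "coprime (s ^ i * (s ^ (j - i) - 1)) (int n)"
        using coprime_s s_unit_dvd by simp
      moreover have "h * (s ^ i * (s ^ (j - i) - 1)) = h * s ^ j - h * s ^ i"
        using 2 by (simp add: algebra_simps flip: power_add)
      ultimately show ?thesis using that d by metis
    next
      case 3
      then have "\<not> m dvd i - j" using i by (simp add: nat_dvd_not_less)
      then have "coprime (- (s ^ j * (s ^ (i - j) - 1))) (int n)"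
        using coprime_s s_unit_dvd by simp
      moreover have "h * (- (s ^ j * (s ^ (i - j) - 1))) = h * s ^ j - h * s ^ i"
        using 3 by (simp add: algebra_simps flip: power_add)
      ultimately show ?thesis using that d by metis
    qed
  qed
  then obtain w where w: "[u * w = 1] (mod int n)" "[h * u = d] (mod int n)"
    using cong_solve_coprime_int by blast
  \<comment> \<open>This \<open>k\<close> solves v + k d = 0 modulo \<open>n\<close>: v is
    \<open>h * s ^ i\<close>, d is \<open>h * u\<close>, and \<open>w\<close> inverts
    \<open>u\<close>.\<close>
  define k where "k = nat ((- (w * s ^ i)) mod int n)"
  have k: "[int k = - (w * s ^ i)] (mod int n)"
    using n_pos by (simp add: k_def)
  have "[v + int k * d = h * s ^ i + (- (w * s ^ i)) * (h * u)] (mod int n)"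
    using i w(2) k by (intro cong_add cong_mult cong_sym[OF w(2)]) (auto simp: cong_def)
  also have "h * s ^ i + (- (w * s ^ i)) * (h * u) = h * s ^ i - (u * w) * (h * s ^ i)"
    by (simp add: algebra_simps)
  also have "[\<dots> = h * s ^ i - 1 * (h * s ^ i)] (mod int n)"
    by (intro cong_diff cong_mult w) auto
  finally have "(v + int k * d) mod int n = 0" by (simp add: cong_def)
  with v[of k] assms(2) show False by simp
qed

text \<open>Each of the \<open>m - 1\<close> binary choices between \<open>b i\<close> and \<open>b (i + m)\<close> enlarges the set of
  values by at least one, and together they may produce at most \<open>m\<close> values. Hence the first two
  choices produce only three values.\<close>

lemma binary_choices:
  assumes m: "m \<ge> 3" and Q: "finite Q" "card Q \<le> m" "0 \<notin> Q"
    and vals: "\<And>g. inj_on g {..<m} \<Longrightarrow> g ` {..<m} \<subseteq> {..<2 * m - 1} \<Longrightarrow> arrangement b g mod int n \<in> Q"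
    and pairs: "\<And>i. i < m - 1 \<Longrightarrow> \<not> [b i = b (i + m)] (mod int n)"
    and perm: "\<pi> permutes {..<m}" and invol: "\<And>i. \<pi> (\<pi> i) = i"
  defines "d \<equiv> \<lambda>j. (b (j + m) - b j) * s ^ \<pi> j"
  shows "int n dvd d 0 - d 1 \<or> int n dvd d 0 + d 1"
proof (rule ccontr)
  assume neg: "\<not> ?thesis"
  \<comment> \<open>\<open>D\<close> records the pairs in which \<open>b (i + m)\<close> is chosen
    instead of \<open>b i\<close>, and \<open>\<pi>\<close> tells which power of \<open>s\<close>
    each pair carries.\<close>
  define V where "V D = (\<Sum>i<m. b (if i \<in> D then i + m else i) * s ^ \<pi> i)" for D
  define A where "A j = (\<lambda>D. V D mod int n) ` Pow {..<j}" for j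
  have V: "V D mod int n \<in> Q" if "D \<subseteq> {..<m - 1}" for D
  proof -
    \<comment> \<open>\<open>V\<close> is indexed by pairs but \<open>arrangement\<close> by
      exponents of \<open>s\<close>; as \<open>\<pi>\<close> is an involution, it also translates
      back.\<close>
    define g where "g k = (if \<pi> k \<in> D then \<pi> k + m else \<pi> k)" for k
    have "V D = arrangement b g"
      unfolding V_def arrangement_def g_def
      by (subst sum.permute[OF perm]) (simp add: invol o_def)
    moreover have lt: "\<pi> k < m" if "k < m" for k
      using permutes_in_image[OF perm, of k] that by simp
    have "inj_on g {..<m}"
    proof (rule inj_onI)
      fix k l assume "k \<in> {..<m}" "l \<in> {..<m}" "g k = g l"
      then have "\<pi> k = \<pi> l"
        using lt[of k] lt[of l] by (auto simp: g_def split: if_splits)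
      then show "k = l" by (metis invol)
    qed
    moreover have "g ` {..<m} \<subseteq> {..<2 * m - 1}"
      using lt that m by (fastforce simp: g_def)
    ultimately show ?thesis using vals by metis
  qed
  have AQ: "A j \<subseteq> Q" if "j \<le> m - 1" for j
  proof
    fix v assume "v \<in> A j"
    then obtain D where D: "D \<subseteq> {..<j}" "v = V D mod int n" by (auto simp: A_def)
    then have "D \<subseteq> {..<m - 1}" using that by auto
    then show "v \<in> Q" using V D by blast
  qed
  have ins: "V (insert j D) = V D + d j" if "j < m" "j \<notin> D" for j D
  proof -
    have "V (insert j D) - V D = (\<Sum>i<m. if i = j then d j else 0)"
      unfolding V_def sum_subtractf[symmetric]
      using that by (intro sum.cong) (auto simp: d_def algebra_simps)
    then show ?thesis using that by simp
  qed
  have step: "A (Suc j) = A j \<union> (\<lambda>v. (v + d j) mod int n) ` A j" if "j < m" for j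
  proof -
    have "Pow {..<Suc j} = Pow {..<j} \<union> insert j ` Pow {..<j}"
      by (simp add: lessThan_Suc Pow_insert)
    then have "A (Suc j) = A j \<union> (\<lambda>D. V (insert j D) mod int n) ` Pow {..<j}"
      by (simp add: A_def image_Un image_image)
    also have "(\<lambda>D. V (insert j D) mod int n) ` Pow {..<j} = (\<lambda>v. (v + d j) mod int n) ` A j"
      unfolding A_def image_image
    proof (intro image_cong)
      fix D assume "D \<in> Pow {..<j}"
      then have "j \<notin> D" by auto
      with ins that show "V (insert j D) mod int n = (V D mod int n + d j) mod int n"
        by (simp add: mod_simps)
    qed simp
    finally show ?thesis .
  qed
  have d0: "\<not> int n dvd d j" if "j < m - 1" for j
  proof -
    have "coprime (s ^ \<pi> j) (int n)" using coprime_s by simp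
    then have "int n dvd d j \<longleftrightarrow> int n dvd b (j + m) - b j"
      unfolding d_def by (simp add: coprime_commute coprime_dvd_mult_left_iff)
    then show ?thesis using pairs[OF that] by (simp add: cong_iff_dvd_diff dvd_diff_commute)
  qed
  have orb: "Q = (\<lambda>i. arrangement b id * s ^ i mod int n) ` {..<m}"
    by (rule orbit_of_arrangements[where I = "{..<2 * m - 1}"]) (use Q vals m in auto)
  have finA: "finite (A j)" for j by (simp add: A_def)
  have grow: "card (A j) + 1 \<le> card (A (Suc j))" if j: "j < m - 1" for j
  proof (rule ccontr)
    assume "\<not> ?thesis"
    \<comment> \<open>A choice that adds no value leaves \<open>A j\<close> invariant under
      translation by \<open>d j\<close>, which \<open>orbit_translate\<close> forbids.\<close>
    then have eq: "A (Suc j) = A j"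
      using card_seteq[of "A (Suc j)" "A j"] step[of j] j finA by auto
    have "V {} mod int n \<in> A j" by (auto simp: A_def)
    then have "(V {} + int k * d j) mod int n \<in> A j" for k
    proof (induction k)
      case (Suc k)
      then have "((V {} + int k * d j) mod int n + d j) mod int n \<in> A (Suc j)"
        using step[of j] j by auto
      then show ?case using eq by (simp add: mod_simps algebra_simps)
    qed simp
    then have "int n dvd d j"
      using AQ[of j] j by (intro orbit_translate[OF orb Q(3)]) auto
    with d0[OF j] show False by blast
  qed
  \<comment> \<open>The \<open>m - 3\<close> choices after the first two each add a value while at
    most \<open>m\<close> are allowed, so at most 3 values remain for \<open>A 2\<close>.\<close>
  have "card (A 2) + k \<le> card (A (2 + k))" if "2 + k \<le> m - 1" for k
    using that
  proof (induction k)
    case (Suc k)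
    then show ?case using grow[of "2 + k"] by simp
  qed simp
  moreover have "2 + (m - 3) = m - 1" using m by simp
  ultimately have "card (A 2) + (m - 3) \<le> card (A (m - 1))" by (metis order_refl)
  also have "card (A (m - 1)) \<le> m"
    using card_mono[OF Q(1) AQ[of "m - 1"]] Q(2) by simp
  finally have "card (A 2) \<le> 3" using m by simp
  moreover have "A 2 = {V {} mod int n, (V {} + d 0) mod int n, (V {} + d 1) mod int n,
      (V {} + d 0 + d 1) mod int n}"
  proof -
    have "A 0 = {V {} mod int n}" by (simp add: A_def)
    then have "A 1 = {V {} mod int n, (V {} + d 0) mod int n}"
      using step[of 0] m by (simp add: mod_simps insert_commute)
    then show ?thesis
      using step[of 1] m by (auto simp: numeral_2_eq_2 mod_simps)
  qed
  \<comment> \<open>The differences of these four values are, up to sign, \<open>d 0\<close>,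
    \<open>d 1\<close>, \<open>d 0 - d 1\<close> and \<open>d 0 + d 1\<close>, none of which
    vanishes.\<close>
  moreover have "card {V {} mod int n, (V {} + d 0) mod int n, (V {} + d 1) mod int n,
      (V {} + d 0 + d 1) mod int n} = 4"
  proof -
    have "\<not> int n dvd d 0" "\<not> int n dvd d 1" by (rule d0; use m in linarith)+
    moreover have "int n dvd - d 0 - d 1 \<longleftrightarrow> int n dvd d 0 + d 1"
      using dvd_minus_iff[of "int n" "d 0 + d 1"] by simp
    ultimately show ?thesis using neg by (auto simp: card_insert_if mod_eq_dvd_iff)
  qed
  ultimately show False by simp
qed

text \<open>Let d_j be the difference of the j-th pair. Applying \<open>binary_choices\<close> to
  the identity and to the swap of the exponents 1 and 2 gives d_0 = +-d_1 s and d_0 = +-d_1 s^2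
  modulo \<open>n\<close>. Subtracting kills d_1, because s - 1 and s + 1 are units: s^2 - 1 is one
  since 2 < m.\<close>

lemma no_small_arrangements:
  assumes "m \<ge> 3" "finite Q" "card Q \<le> m" "0 \<notin> Q"
    and "\<And>g. inj_on g {..<m} \<Longrightarrow> g ` {..<m} \<subseteq> {..<2 * m - 1} \<Longrightarrow> arrangement b g mod int n \<in> Q"
    and pairs: "\<And>i. i < m - 1 \<Longrightarrow> \<not> [b i = b (i + m)] (mod int n)"
  shows False
proof -
  let ?d = "\<lambda>j. b (j + m) - b j"
  have bc: "int n dvd ?d 0 * s ^ \<pi> 0 - ?d 1 * s ^ \<pi> 1 \<or> int n dvd ?d 0 * s ^ \<pi> 0 + ?d 1 * s ^ \<pi> 1"
    if "\<pi> permutes {..<m}" "\<And>i. \<pi> (\<pi> i) = i" for \<pi>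
    by (rule binary_choices[where Q = Q]) (fact assms | fact that)+
  have "int n dvd ?d 0 - ?d 1 * s \<or> int n dvd ?d 0 + ?d 1 * s"
    using bc[of id] by (simp add: permutes_id)
  moreover have "int n dvd ?d 0 - ?d 1 * s\<^sup>2 \<or> int n dvd ?d 0 + ?d 1 * s\<^sup>2"
    using bc[of "transpose 1 2"] assms(1) by (simp add: permutes_swap_id)
  moreover have "int n dvd ?d 1 * (s * (s - 1))"
    if "int n dvd ?d 0 - ?d 1 * s" "int n dvd ?d 0 - ?d 1 * s\<^sup>2"
    using dvd_diff[OF that] by (simp add: algebra_simps power2_eq_square)
  moreover have "int n dvd ?d 1 * (s * (s + 1))"
    if "int n dvd ?d 0 + ?d 1 * s\<^sup>2" "int n dvd ?d 0 - ?d 1 * s"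
    using dvd_diff[OF that] by (simp add: algebra_simps power2_eq_square)
  moreover have "int n dvd ?d 1 * (s * (s + 1))"
    if "int n dvd ?d 0 + ?d 1 * s" "int n dvd ?d 0 - ?d 1 * s\<^sup>2"
    using dvd_diff[OF that] by (simp add: algebra_simps power2_eq_square)
  moreover have "int n dvd ?d 1 * (s * (s - 1))"
    if "int n dvd ?d 0 + ?d 1 * s\<^sup>2" "int n dvd ?d 0 + ?d 1 * s"
    using dvd_diff[OF that] by (simp add: algebra_simps power2_eq_square)
  ultimately have "int n dvd ?d 1 * (s * (s - 1)) \<or> int n dvd ?d 1 * (s * (s + 1))"
    by blast
  moreover have "coprime (s * (s - 1)) (int n)"
    using coprime_s s_unit[of 1] assms(1) by simp
  moreover have "coprime (s * (s + 1)) (int n)"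
  proof -
    have "s\<^sup>2 - 1 = (s - 1) * (s + 1)" by (simp add: power2_eq_square algebra_simps)
    then show ?thesis using coprime_s s_unit[of 2] assms(1) by simp
  qed
  ultimately have "int n dvd ?d 1"
    by (simp add: coprime_commute coprime_dvd_mult_left_iff)
  then show False
    using pairs[of 1] assms(1) less_diff_conv[of 1 m 1]
    by (simp add: cong_iff_dvd_diff dvd_diff_commute)
qed

text \<open>Here \<open>s\<close> is -1 modulo \<open>n\<close>, so \<open>Q\<close> contains all
  differences of the three exponents. As 2 is a unit, d and -d are distinct for d = b 1 - b 0 and
  exhaust \<open>Q\<close>; hence the exponents form an arithmetic progression that closes up, with
  3 d = 0.\<close>

lemma dihedral_triple:
  assumes m: "m = 2" and Q: "finite Q" "card Q \<le> 2" "0 \<notin> Q"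
    and vals: "\<And>i j. i < 3 \<Longrightarrow> j < 3 \<Longrightarrow> i \<noteq> j \<Longrightarrow> (b i * s + b j) mod int n \<in> Q" 
  shows "\<not> [b 0 = b 1] (mod int n)" "int n dvd 3 * (b 1 - b 0)" "[b 2 = 2 * b 1 - b (0::nat)] (mod int n)"
    "Q = {(b 1 - b 0) mod int n, (b 0 - b 1) mod int n}"
proof -
  have cop: "coprime (s - 1) (int n)" using s_unit[of 1] m by simp
  have "int n dvd (s - 1) * (s + 1)"
    using s_pow m by (simp add: cong_iff_dvd_diff power2_eq_square algebra_simps)
  then have s1: "[s = -1] (mod int n)"
    using cop by (simp add: cong_iff_dvd_diff coprime_commute coprime_dvd_mult_right_iff)
  have diff: "(b j - b i) mod int n \<in> Q" if "i < 3" "j < 3" "i \<noteq> j" for i j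
  proof -
    have "[b i * s + b j = b i * (-1) + b j] (mod int n)"
      by (intro cong_add cong_mult s1) auto
    then show ?thesis using vals[OF that] by (simp add: cong_def algebra_simps)
  qed
  have nd: "\<not> int n dvd b j - b i" if "i < 3" "j < 3" "i \<noteq> j" for i j
    using diff[OF that] Q(3) by auto
  show "\<not> [b 0 = b 1] (mod int n)" using nd[of 1 0] by (simp add: cong_iff_dvd_diff)
  have "coprime 2 (int n)"
  proof -
    have "[s - 1 = -1 - 1] (mod int n)" by (intro cong_diff s1) auto
    then have "coprime (-2) (int n)" using cop cong_imp_coprime by fastforce
    then show ?thesis by simp
  qed
  then have two: "int n dvd 2 * x \<longleftrightarrow> int n dvd x" for x
    by (simp add: coprime_commute coprime_dvd_mult_right_iff)
  let ?d = "b 1 - b 0" and ?e = "b 2 - b 1"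
  have ne: "?d mod int n \<noteq> (- ?d) mod int n"
    using two[of ?d] nd[of 0 1] by (simp add: mod_eq_dvd_iff)
  have sub: "{?d mod int n, (- ?d) mod int n} \<subseteq> Q"
    using diff[of 0 1] diff[of 1 0] by simp
  then have Qe: "Q = {?d mod int n, (- ?d) mod int n}"
    using card_seteq[OF Q(1) sub] Q(2) ne by simp
  then show "Q = {?d mod int n, (b 0 - b 1) mod int n}" by simp
  have "?e mod int n \<noteq> (- ?d) mod int n"
    using nd[of 0 2] by (simp add: mod_eq_dvd_iff)
  then have e: "?e mod int n = ?d mod int n" using diff[of 1 2] Qe by simp
  then show "[b 2 = 2 * b 1 - b 0] (mod int n)"
    by (simp add: cong_iff_dvd_diff mod_eq_dvd_iff algebra_simps)
  have "(b 2 - b 0) mod int n \<noteq> ?d mod int n"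
    using nd[of 1 2] by (simp add: mod_eq_dvd_iff)
  then have "(b 2 - b 0) mod int n = (- ?d) mod int n" using diff[of 0 2] Qe by simp
  then have "int n dvd (b 2 - b 0) + ?d" "int n dvd ?e - ?d"
    using e by (simp_all add: mod_eq_dvd_iff)
  then have "int n dvd ((b 2 - b 0) + ?d) - (?e - ?d)" by (rule dvd_diff)
  then show "int n dvd 3 * ?d" by (simp add: algebra_simps)
qed


section \<open>Classification of the extremal multisets of pairs\<close>

lemma pofD: "pof S \<Longrightarrow> mset ps \<subseteq># S \<Longrightarrow> ps \<noteq> [] \<Longrightarrow> m dvd fst (pprod ps) \<Longrightarrow> \<not> int n dvd snd (pprod ps)"
  unfolding pof_def by blast

lemma pprod_fst_zero:
  assumes "\<And>p. p \<in> set ps \<Longrightarrow> fst p = 0"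
  shows "pprod ps = (0, \<Sum>p\<leftarrow>ps. snd p)"
  using assms by (induction ps) auto

text \<open>The list is reversed because the last factor is the one multiplied by power 0; thus
  index k meets exponent k, as in \<open>arrangement\<close>.\<close>

lemma pprod_coset:
  "pprod (map (\<lambda>k. (a, f k)) (rev [0..<l])) = (l * a, \<Sum>k<l. f k * (s ^ a) ^ k)"
  by (induction l) (auto simp: mult.commute simp flip: power_mult)

text \<open>With first components 0 products become sums, so \<open>K\<close> is an extremal
  zero-sum free sequence modulo \<open>n\<close>; the bounds turn congruent exponents into equal
  ones.\<close>

lemma cyclic_classification:
  assumes K: "pof K" "size K = n - 1" and bnd: "\<And>p. p \<in># K \<Longrightarrow> fst p = 0 \<and> 0 \<le> snd p \<and> snd p < int n"
  obtains c :: nat where "coprime c n" "K = replicate_mset (n - 1) (0, int c)"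
proof (cases "K = {#}")
  case True
  with K(2) n_pos have "n = 1" by simp
  \<comment> \<open>For n = 1 there are no terms and \<open>c\<close> is an arbitrary
    choice.\<close>
  with True that[of 1] show ?thesis by simp
next
  case False
  then obtain p where p: "p \<in># K" by blast
  have "zero_sum_free snd n K"
    unfolding zero_sum_free_def
  proof (intro allI impI)
    fix T assume T: "T \<subseteq># K" "T \<noteq> {#}"
    obtain ps where ps: "mset ps = T" using ex_mset by blast
    have "pprod ps = (0, \<Sum>p\<leftarrow>ps. snd p)"
      using bnd T ps by (intro pprod_fst_zero) (metis mset_subset_eqD set_mset_mset)
    then show "\<not> int n dvd (\<Sum>p\<in>#T. snd p)"
      using pofD[OF K(1), of ps] T ps by (auto simp flip: sum_mset_sum_list)
  qed
  note zs = zero_sum_free_size[OF n_pos this]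
  define c where "c = nat (snd p)"
  have "q = (0, int c)" if q: "q \<in># K" for q
  proof -
    have "snd q = snd p"
    proof (cases "q = p")
      case False
      then have "q \<in># K - {#p#}" using q p by (metis insert_DiffM insert_noteq_member)
      then have "[snd p = snd q] (mod int n)" using zs(2)[OF K(2) p] by blast
      then show ?thesis using bnd[OF p] bnd[OF q] by (simp add: cong_def)
    qed simp
    then show ?thesis using bnd[OF q] by (simp add: c_def prod_eq_iff)
  qed
  then have "set_mset K \<subseteq> {(0, int c)}" by blast
  then have "K = replicate_mset (n - 1) (0, int c)"
    using K(2) by (metis set_mset_subset_singletonD)
  moreover have "coprime c n"
    using zs(3)[OF K(2) p] bnd[OF p] by (simp add: c_def flip: coprime_int_iff)
  ultimately show ?thesis using that by blast
qed

text \<open>For m at least 3, \<open>card_ysums_complement\<close> leaves 2 m - 1 terms of the coset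
  at most m + 1 products including the empty one, which contradicts
  \<open>no_small_arrangements\<close> for the multiplier \<open>s ^ a\<close>.\<close>

lemma coset_excess:
  assumes m: "m \<ge> 2" and S: "pof S" "size S = m + n - 2"
    and bnd: "\<And>p. p \<in># S \<Longrightarrow> (fst p = 0 \<or> fst p = a) \<and> 0 \<le> snd p \<and> snd p < int n"
    and a: "coprime a m"
    and N: "m dvd size (filter_mset (\<lambda>p. fst p = a) S) + 1" "size (filter_mset (\<lambda>p. fst p = a) S) \<ge> 2 * m - 1"
  shows "m = 2"
proof (rule ccontr)
  assume "m \<noteq> 2"
  with m have m3: "m \<ge> 3" by simp
  \<comment> \<open>Terms of the coset x^a act on the normal subgroup through \<open>s ^ a\<close>;
    coprimality of \<open>a\<close> and \<open>m\<close> preserves the locale assumptions.\<close>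
  interpret T: frobenius_pairs m n "s ^ a"
  proof
    show "[(s ^ a) ^ m = 1] (mod int n)"
      by (simp add: s_pow_dvd flip: power_mult)
    show "coprime ((s ^ a) ^ i - 1) (int n)" if "0 < i" "i < m" for i
    proof -
      have "\<not> m dvd i" using that by (simp add: nat_dvd_not_less)
      then have "\<not> m dvd a * i"
        using a by (metis coprime_commute coprime_dvd_mult_right_iff)
      then show ?thesis using s_unit_dvd by (simp flip: power_mult)
    qed
  qed (use m_pos n_pos in auto)
  define M where "M = filter_mset (\<lambda>p. fst p = a) S"
  \<comment> \<open>Sorting makes the pairing work: equal entries at distance m bound a constant
    run, whose first m terms would multiply to 1 by \<open>geometric_dvd\<close>.\<close>
  define bs where "bs = sorted_list_of_multiset (image_mset snd M)"
  define b where "b k = bs ! k" for k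
  define F where "F = image_mset (\<lambda>k. (a, b k)) (mset_set {..<2 * m - 1})"
  have M: "M = image_mset (Pair a) (mset bs)"
  proof -
    have "image_mset (Pair a) (mset bs) = image_mset (\<lambda>p. (a, snd p)) M"
      by (simp add: bs_def multiset.map_comp o_def)
    also have "\<dots> = image_mset (\<lambda>p. p) M"
      by (intro image_mset_cong) (auto simp: M_def)
    finally show ?thesis by simp
  qed
  have len: "length bs = size M" by (metis M size_image_mset size_mset)
  have FM: "F \<subseteq># M"
  proof -
    have "F = image_mset (Pair a) (mset (map b [0..<2 * m - 1]))"
      unfolding F_def by (simp add: multiset.map_comp o_def atLeast0LessThan flip: mset_set_upto_eq_mset_upto)
    also have "map b [0..<2 * m - 1] = take (2 * m - 1) bs"
      using N(2) len by (intro nth_equalityI) (auto simp: b_def M_def)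
    also have "image_mset (Pair a) (mset (take (2 * m - 1) bs)) \<subseteq># M"
      unfolding M by (intro image_mset_subseteq_mono)
        (metis append_take_drop_id mset_append mset_subset_eq_add_left)
    finally show ?thesis .
  qed
  then have FS: "F \<subseteq># S" unfolding M_def by (meson multiset_filter_subset subset_mset.trans)
  have sF: "size F = 2 * m - 1" by (simp add: F_def)
  have degF: "deg U = a * size (filter_mset (\<lambda>p. fst p = a) U)" if "U \<subseteq># S" for U
  proof -
    have "p \<in># U \<Longrightarrow> fst p = 0 \<or> fst p = a" for p
      using bnd mset_subset_eqD[OF that] by blast
    then show ?thesis by (induction U) auto
  qed
  \<comment> \<open>The coset has -1 modulo m many terms, and so has \<open>F\<close>; the number of
    its terms outside \<open>F\<close> is a multiple of m.\<close>
  have "m dvd deg (S - F)"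
  proof -
    have "filter_mset (\<lambda>p. fst p = a) F = F"
      by (simp add: F_def filter_mset_eq_conv)
    then have "filter_mset (\<lambda>p. fst p = a) (S - F) = M - F"
      by (simp add: M_def)
    then have "deg (S - F) = a * (size M - (2 * m - 1))"
      using degF[of "S - F"] FM sF by (simp add: size_Diff_submset)
    moreover have "m dvd (size M + 1) - 2 * m"
      using N(1) unfolding M_def by (intro dvd_diff_nat) auto
    moreover have "(size M + 1) - 2 * m = size M - (2 * m - 1)" using m by simp
    ultimately show ?thesis by (simp only: dvd_mult)
  qed
  from card_ysums_complement[OF S(1) FS this]
  have "card (ysums F) + (m + n - 2 - (2 * m - 1)) \<le> n"
    using FS sF S(2) by (simp add: size_Diff_submset)
  moreover have "2 * m - 1 \<le> m + n - 2" using size_mset_mono[OF FS] sF S(2) by simp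
  ultimately have cF: "card (ysums F) \<le> m + 1" using m by linarith
  define Q where "Q = ysums F - {0}"
  have Q: "finite Q" "card Q \<le> m" "0 \<notin> Q" using cF by (auto simp: Q_def)
  have vals: "T.arrangement b g mod int n \<in> Q"
    if "inj_on g {..<m}" "g ` {..<m} \<subseteq> {..<2 * m - 1}" for g
  proof -
    define ps where "ps = map (\<lambda>k. (a, b (g k))) (rev [0..<m])"
    have "mset ps = image_mset (\<lambda>k. (a, b k)) (image_mset g (mset_set {..<m}))"
      by (simp add: ps_def multiset.map_comp o_def atLeast0LessThan rev_map flip: mset_set_upto_eq_mset_upto)
    also have "\<dots> = image_mset (\<lambda>k. (a, b k)) (mset_set (g ` {..<m}))"
      using that by (simp add: image_mset_mset_set)
    also have "\<dots> \<subseteq># F"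
      unfolding F_def using that by (intro image_mset_subseteq_mono subset_imp_msubset_mset_set) auto
    finally have psF: "mset ps \<subseteq># F" .
    have pp: "pprod ps = (m * a, T.arrangement b g)"
      unfolding ps_def pprod_coset T.arrangement_def by simp
    have "ps \<noteq> []" using m_pos by (simp add: ps_def)
    then have "\<not> int n dvd T.arrangement b g"
      using pofD[OF S(1), of ps] psF FS pp by (auto intro: subset_mset.trans)
    moreover have "T.arrangement b g mod int n \<in> ysums F"
      using ysumsI[OF psF] pp by simp
    ultimately show ?thesis by (auto simp: Q_def dvd_eq_mod_eq_0)
  qed
  have "\<not> [b i = b (i + m)] (mod int n)" if i: "i < m - 1" for i
  proof
    assume cong: "[b i = b (i + m)] (mod int n)"
    have iN: "i + m < length bs" using i N(2) len by (simp add: M_def)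
    have rng: "0 \<le> b k \<and> b k < int n" if "k < length bs" for k
    proof -
      have "(a, b k) \<in># M" using that by (auto simp: M b_def)
      then show ?thesis using bnd[of "(a, b k)"] by (simp add: M_def)
    qed
    have eq: "b i = b (i + m)"
      using cong rng[of i] rng[of "i + m"] iN by (simp add: cong_def)
    have sorted: "sorted bs" by (simp add: bs_def)
    have const: "b (i + k) = b i" if "k < m" for k
      using sorted_nth_mono[OF sorted, of i "i + k"] sorted_nth_mono[OF sorted, of "i + k" "i + m"]
        eq iN that by (simp add: b_def)
    have "T.arrangement b (\<lambda>k. i + k) = b i * (\<Sum>k<m. (s ^ a) ^ k)"
      unfolding T.arrangement_def sum_distrib_left using const by (intro sum.cong) auto
    then have "int n dvd T.arrangement b (\<lambda>k. i + k)"
      using T.geometric_dvd[OF m] by simp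
    moreover have "T.arrangement b (\<lambda>k. i + k) mod int n \<in> Q"
      using i by (intro vals) (auto simp: inj_on_def)
    ultimately show False using Q(3) by simp
  qed
  with T.no_small_arrangements[OF m3 Q vals] show False by blast
qed

text \<open>Removing three terms of degree 1 from odd total degree leaves an even degree, so
  \<open>card_ysums_complement\<close> allows the triple only two nonzero products, as
  \<open>dihedral_triple\<close> requires.\<close>

lemma dihedral_triple_in:
  assumes m: "m = 2" and S: "pof S" "size S = n" "odd (deg S)"
    and F: "{#(1, b0), (1, b1), (1, b2)#} \<subseteq># S"
  shows "\<not> [b0 = b1] (mod int n)" "int n dvd 3 * (b1 - b0)" "[b2 = 2 * b1 - b0] (mod int n)"
    "ysums {#(1, b0), (1, b1), (1, b2)#} = {0, (b1 - b0) mod int n, (b0 - b1) mod int n}"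
proof -
  let ?F = "{#(1, b0), (1, b1), (1, b2)#} :: (nat \<times> int) multiset"
  define b where "b i = [b0, b1, b2] ! i" for i
  have b: "b 0 = b0" "b 1 = b1" "b 2 = b2" by (simp_all add: b_def)
  have "deg S = deg ?F + deg (S - ?F)" using F by (metis deg_add subset_mset.add_diff_inverse)
  then have "m dvd deg (S - ?F)" using S(3) m by simp
  from card_ysums_complement[OF S(1) F this] have "card (ysums ?F) \<le> 3"
    using size_mset_mono[OF F] S(2) F by (simp add: size_Diff_submset)
  then have Q: "finite (ysums ?F - {0})" "card (ysums ?F - {0}) \<le> 2" "0 \<notin> ysums ?F - {0}"
    by auto
  have vals: "(b i * s + b j) mod int n \<in> ysums ?F - {0}" if "i < 3" "j < 3" "i \<noteq> j" for i j
  proof -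
    have "i = 0 \<or> i = 1 \<or> i = 2" "j = 0 \<or> j = 1 \<or> j = 2" using that by linarith+
    then have sub: "mset [(1, b i), (1, b j)] \<subseteq># ?F"
      using that(3) by (auto simp: b_def)
    have "pprod [(1, b i), (1, b j)] = (2, b i * s + b j)" by simp
    then show ?thesis
      using ysumsI[OF sub] pofD[OF S(1), of "[(1, b i), (1, b j)]"] sub F m
      by (auto simp del: pprod_simps intro: subset_mset.trans)
  qed
  have dt: "\<not> [b 0 = b 1] (mod int n)" "int n dvd 3 * (b 1 - b 0)" "[b 2 = 2 * b 1 - b 0] (mod int n)"
    "ysums ?F - {0} = {(b 1 - b 0) mod int n, (b 0 - b 1) mod int n}"
    by (rule dihedral_triple[OF m Q, where b = b], erule (2) vals)+
  show "\<not> [b0 = b1] (mod int n)" "int n dvd 3 * (b1 - b0)" "[b2 = 2 * b1 - b0] (mod int n)"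
    using dt(1-3) unfolding b by simp_all
  show "ysums ?F = {0, (b1 - b0) mod int n, (b0 - b1) mod int n}"
    using dt(4) unfolding b by (metis insert_Diff_single insert_absorb zero_in_ysums)
qed

end

lemma three_elements:
  assumes "size M \<ge> 3"
  obtains x y z M' where "M = {#x, y, z#} + M'"
proof -
  obtain xs where "mset xs = M" using ex_mset by blast
  moreover from this assms obtain x y z ys where "xs = x # y # z # ys"
    by (auto simp: numeral_3_eq_3 Suc_le_length_iff)
  ultimately show ?thesis using that[of x y z "mset ys"] by auto
qed

context frobenius_pairs
begin

text \<open>Any two of the reflections determine a third, so there are exactly three. If n were not
  3, the remaining terms would all be d or -d for an element d with 3 d = 0, and three of them would
  contain a zero sum.\<close>

lemma dihedral_excess:
  assumes m: "m = 2" and S: "pof S" "size S = m + n - 2"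
    and bnd: "\<And>p. p \<in># S \<Longrightarrow> (fst p = 0 \<or> fst p = 1) \<and> 0 \<le> snd p \<and> snd p < int n"
    and N: "odd (size (filter_mset (\<lambda>p. fst p = 1) S))" "size (filter_mset (\<lambda>p. fst p = 1) S) \<ge> 3"
  shows "n = 3 \<and> S = {#(1, 0), (1, 1), (1, 2)#}"
proof -
  let ?M = "filter_mset (\<lambda>p. fst p = 1) S"
  have sS: "size S = n" using S m by simp
  have "\<And>p. p \<in># S \<Longrightarrow> fst p = 0 \<or> fst p = 1" using bnd by blast
  then have "deg S = size ?M" by (induction S) auto
  then have oddS: "odd (deg S)" using N by simp
  note triple = dihedral_triple_in[OF m S(1) sS oddS]
  have fst_M: "\<exists>b. p = (1, b)" if "p \<in># ?M" for p
    using that by (cases p) auto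
  have MS: "?M \<subseteq># S" by (rule multiset_filter_subset)
  obtain p0 p1 p2 M' where M0: "?M = {#p0, p1, p2#} + M'" using three_elements[OF N(2)] by blast
  have "p0 \<in># ?M" "p1 \<in># ?M" "p2 \<in># ?M" unfolding M0 by auto
  then obtain b0 b1 b2 where b: "p0 = (1, b0)" "p1 = (1, b1)" "p2 = (1, b2)"
    using fst_M by meson
  define F :: "(nat \<times> int) multiset" where "F = {#(1, b0), (1, b1), (1, b2)#}"
  have M: "?M = F + M'" using M0 b by (simp add: F_def)
  then have FS: "F \<subseteq># S" using MS by (metis mset_subset_eq_add_left subset_mset.trans)
  note t012 = triple[OF FS[unfolded F_def]]
  have "M' = {#}"
  proof (rule ccontr)
    assume "M' \<noteq> {#}"
    then obtain p3 M'' where M3: "M' = add_mset p3 M''" by (metis multiset_cases)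
    have "p3 \<in># ?M" unfolding M M3 by simp
    then obtain b3 where b3: "p3 = (1, b3)" using fst_M by blast
    have sub: "F + {#(1, b3)#} \<subseteq># S"
      using MS unfolding M M3 b3 by (metis add_mset_add_single mset_subset_eq_add_left subset_mset.trans union_mset_add_mset_right union_mset_add_mset_left)
    \<comment> \<open>A fourth exponent \<open>b3\<close> continues the progression b0, b1 just as
      \<open>b2\<close> does, but the triple b2, b3, b0 needs b2 and b3 distinct.\<close>
    have "{#(1, b0), (1, b1), (1, b3)#} \<subseteq># F + {#(1, b3)#}"
      by (simp add: F_def)
    then have "[b3 = 2 * b1 - b0] (mod int n)"
      using triple(3) sub subset_mset.trans by blast
    moreover have "{#(1, b2), (1, b3), (1, b0)#} \<subseteq># F + {#(1, b3)#}"
      by (simp add: F_def)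
    then have "\<not> [b2 = b3] (mod int n)"
      using triple(1) sub subset_mset.trans by blast
    ultimately show False using t012(3) by (meson cong_sym cong_trans)
  qed
  then have MF: "?M = F" using M by simp
  define K where "K = S - F"
  have SK: "S = F + K" using FS by (simp add: K_def)
  have sK: "size K + 3 = n" using sS SK by (auto simp: F_def)
  have fst_K: "fst p = 0" if "p \<in># K" for p
  proof -
    have "K = filter_mset (\<lambda>p. fst p \<noteq> 1) S"
      unfolding K_def MF[symmetric] by (metis add_diff_cancel_left' multiset_partition)
    with that have "p \<in># S" "fst p \<noteq> 1" by simp_all
    with bnd[of p] show ?thesis by blast
  qed
  have "n = 3"
  proof (rule ccontr)
    assume "n \<noteq> 3"
    define d where "d = b1 - b0"
    have d: "\<not> int n dvd d" "int n dvd 3 * d"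
      using t012(1,2) unfolding d_def by (simp_all add: cong_iff_dvd_diff dvd_diff_commute)
    \<comment> \<open>A nonzero d with 3 d = 0 forces 3 to divide n. This excludes 4 and 5, so n is
      at least 6 and \<open>K\<close> has at least three terms.\<close>
    have "\<not> coprime 3 (int n)"
      using d by (metis coprime_commute coprime_dvd_mult_right_iff)
    then have "n \<noteq> 4" "n \<noteq> 5"
      by (auto simp: coprime_iff_gcd_eq_1 gcd_non_0_int)
    then have sK3: "size K \<ge> 3" using sK \<open>n \<noteq> 3\<close> by linarith
    \<comment> \<open>Otherwise 0, d, -d, c and d + c are five distinct products of
      \<open>F'\<close>, while \<open>card_ysums_complement\<close> allows four.\<close>
    have cK: "int n dvd c - d \<or> int n dvd c + d" if c: "(0, c) \<in># K" for c
    proof (rule ccontr)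
      assume neg: "\<not> ?thesis"
      define F' where "F' = F + {#(0, c)#}"
      have F'S: "F' \<subseteq># S" using c by (simp add: F'_def SK)
      then have "deg S = deg F' + deg (S - F')" by (metis deg_add subset_mset.add_diff_inverse)
      then have "m dvd deg (S - F')" using oddS m by (simp add: F'_def F_def)
      from card_ysums_complement[OF S(1) F'S this] have "card (ysums F') \<le> 4"
        using size_mset_mono[OF F'S] F'S sS by (simp add: size_Diff_submset F'_def F_def)
      moreover have "{0, d mod int n, (- d) mod int n} \<subseteq> ysums F'"
        using ysums_mono[of F F'] t012(4) by (auto simp: F'_def F_def d_def)
      moreover have "c mod int n \<in> ysums F'"
        using ysumsI[of "[(0, c)]" F'] by (simp add: F'_def)
      moreover have "(d + c) mod int n \<in> ysums F'"
      proof -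
        have "d mod int n \<in> ysums F" using t012(4) by (simp add: F_def d_def)
        then obtain ps where ps: "mset ps \<subseteq># F" "m dvd fst (pprod ps)" "d mod int n = snd (pprod ps) mod int n"
          unfolding ysums_def by auto
        have "snd (pprod (ps @ [(0, c)])) mod int n = (d + c) mod int n"
          using ps(3) by (simp add: pprod_append) (metis mod_add_left_eq)
        moreover have "snd (pprod (ps @ [(0, c)])) mod int n \<in> ysums F'"
          using ps by (intro ysumsI) (simp_all add: F'_def pprod_append)
        ultimately show ?thesis by simp
      qed
      ultimately have le4: "card {0, d mod int n, (- d) mod int n, c mod int n, (d + c) mod int n} \<le> 4"
        by (meson card_mono finite_ysums insert_subset empty_subsetI order_trans)
      have "\<not> int n dvd c"
        using pofD[OF S(1), of "[(0, c)]"] c SK by simp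
      moreover have "\<not> int n dvd 2 * d"
      proof
        assume "int n dvd 2 * d"
        then have "int n dvd 3 * d - 2 * d" using d(2) by (rule dvd_diff[rotated])
        with d(1) show False by simp
      qed
      moreover have "\<not> int n dvd 2 * d + c"
      proof
        assume "int n dvd 2 * d + c"
        then have "int n dvd (2 * d + c) - 3 * d" using d(2) by (rule dvd_diff)
        with neg show False by simp
      qed
      moreover have "\<not> int n dvd - d - c" "\<not> int n dvd - c - d"
      proof -
        have "- d - c = - (c + d)" "- c - d = - (c + d)" by simp_all
        then show "\<not> int n dvd - d - c" "\<not> int n dvd - c - d"
          using neg by (simp_all only: dvd_minus_iff) blast+
      qed
      ultimately have "distinct [0 mod int n, d mod int n, (- d) mod int n, c mod int n, (d + c) mod int n]"
        using d(1) neg dvd_minus_iff[of "int n" "2 * d + c"]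
        unfolding distinct.simps list.set insert_iff empty_iff mod_eq_dvd_iff
        by (simp add: dvd_diff_commute[of "int n" c d] add.commute[of d c])
      from distinct_card[OF this]
      have "card {0, d mod int n, (- d) mod int n, c mod int n, (d + c) mod int n} = 5"
        by simp
      with le4 show False by simp
    qed
    obtain q1 q2 q3 K3 where K1: "K = {#q1, q2, q3#} + K3" using three_elements[OF sK3] by blast
    define c1 c2 c3 where "c1 = snd q1" and "c2 = snd q2" and "c3 = snd q3"
    have "q1 \<in># K" "q2 \<in># K" "q3 \<in># K" unfolding K1 by auto
    then have "q1 = (0, c1)" "q2 = (0, c2)" "q3 = (0, c3)"
      unfolding c1_def c2_def c3_def prod_eq_iff using fst_K by simp_all
    then have K: "K = {#(0, c1), (0, c2), (0, c3)#} + K3" using K1 by simp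
    have sub: "{#(0, c1), (0, c2), (0, c3)#} \<subseteq># S"
      unfolding SK K by (simp add: subset_mset.add_increasing)
    have nz: "\<not> int n dvd (\<Sum>p\<leftarrow>ps. snd p)"
      if "mset ps \<subseteq># {#(0, c1), (0, c2), (0, c3)#}" "ps \<noteq> []" for ps :: "(nat \<times> int) list"
    proof -
      have "pprod ps = (0, \<Sum>p\<leftarrow>ps. snd p)"
      proof (rule pprod_fst_zero)
        fix p assume "p \<in> set ps"
        then show "fst p = 0" using mset_subset_eqD[OF that(1), of p] by auto
      qed
      then show ?thesis
        using pofD[OF S(1), of ps] sub that subset_mset.trans[OF that(1) sub] by simp
    qed
    have nz': "\<not> int n dvd c1 + c2" "\<not> int n dvd c1 + c3" "\<not> int n dvd c2 + c3" "\<not> int n dvd c1 + c2 + c3"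
      using nz[of "[(0, c1), (0, c2)]"] nz[of "[(0, c1), (0, c3)]"]
        nz[of "[(0, c2), (0, c3)]"] nz[of "[(0, c1), (0, c2), (0, c3)]"]
      by (simp_all add: add.assoc)
    have opp: False if "int n dvd x - d" "int n dvd y + d" "\<not> int n dvd x + y" for x y
      using dvd_add[OF that(1,2)] that(3) by simp
    have same: False if "int n dvd c1 - e" "int n dvd c2 - e" "int n dvd c3 - e" "int n dvd 3 * e" for e
      using dvd_add[OF dvd_add[OF dvd_add[OF that(1,2)] that(3)] that(4)] nz'(4) by (simp add: algebra_simps)
    \<comment> \<open>Each of the three terms is d or -d: two opposite ones sum to 0, and three
      equal ones do because 3 d = 0.\<close>
    have "\<not> (int n dvd c1 - d \<and> int n dvd c2 + d)" "\<not> (int n dvd c2 - d \<and> int n dvd c1 + d)"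
      "\<not> (int n dvd c1 - d \<and> int n dvd c3 + d)" "\<not> (int n dvd c3 - d \<and> int n dvd c1 + d)"
      "\<not> (int n dvd c2 - d \<and> int n dvd c3 + d)" "\<not> (int n dvd c3 - d \<and> int n dvd c2 + d)"
      using opp nz'(1-3) by (metis add.commute)+
    moreover have "\<not> (int n dvd c1 - d \<and> int n dvd c2 - d \<and> int n dvd c3 - d)"
      using same[of d] d(2) by blast
    moreover have "\<not> (int n dvd c1 + d \<and> int n dvd c2 + d \<and> int n dvd c3 + d)"
      using same[of "- d"] d(2) by auto
    moreover have "int n dvd c1 - d \<or> int n dvd c1 + d" "int n dvd c2 - d \<or> int n dvd c2 + d"
      "int n dvd c3 - d \<or> int n dvd c3 + d"
      by (intro cK; simp add: K)+
    ultimately show False by blast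
  qed
  moreover have "S = {#(1, 0), (1, 1), (1, 2)#}"
  proof -
    have "K = {#}" using sK \<open>n = 3\<close> by simp
    then have SF: "S = {#(1, b0), (1, b1), (1, b2)#}" using SK by (simp add: F_def)
    have "b0 = 0 \<or> b0 = 1 \<or> b0 = 2" "b1 = 0 \<or> b1 = 1 \<or> b1 = 2" "b2 = 0 \<or> b2 = 1 \<or> b2 = 2"
      using bnd[of "(1, b0)"] bnd[of "(1, b1)"] bnd[of "(1, b2)"] \<open>n = 3\<close> SF by auto
    moreover have "b0 \<noteq> b1" using t012(1) by auto
    moreover have "b0 \<noteq> b2" using triple(1)[of b0 b2 b1] SF by (auto simp: add_mset_commute)
    moreover have "b1 \<noteq> b2" using triple(1)[of b1 b2 b0] SF by (auto simp: add_mset_commute)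
    ultimately show ?thesis unfolding SF by (auto simp: add_mset_commute)
  qed
  ultimately show ?thesis by blast
qed

text \<open>The number of terms in the generating coset is m j - 1. For j = 1 the others form an
  extremal sequence over a cyclic group; for larger j there are at least 2 m - 1, and the excess
  lemmas leave only the exceptional triple. The case m = 1 has no nontrivial coset and is
  separate.\<close>

theorem pof_classification:
  assumes S: "pof S" "size S = m + n - 2"
    and bnd: "\<And>p. p \<in># S \<Longrightarrow> fst p < m \<and> 0 \<le> snd p \<and> snd p < int n"
  shows "(\<exists>a c M. coprime a m \<and> coprime c n \<and> size M = m - 1 \<and> (\<forall>p\<in>#M. fst p = a) \<and>
            S = M + replicate_mset (n - 1) (0, int c)) \<or>
         (m = 2 \<and> n = 3 \<and> S = {#(1, 0), (1, 1), (1, 2)#})"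
proof (cases "m = 1")
  case True
  then obtain c where "coprime c n" "S = replicate_mset (n - 1) (0, int c)"
    using cyclic_classification[OF S(1)] S(2) bnd by auto
  \<comment> \<open>For m = 1 the coset part is empty; \<open>a = 1\<close> is an arbitrary
    witness.\<close>
  with True show ?thesis by (intro disjI1 exI[of _ 1] exI[of _ c] exI[of _ "{#}"]) auto
next
  case False
  then have m: "m \<ge> 2" using m_pos by simp
  obtain a where a: "coprime a m" "0 < a" "a < m" "\<And>p. p \<in># S \<Longrightarrow> fst p = 0 \<or> fst p = a"
    "m dvd size (filter_mset (\<lambda>p. fst p = a) S) + 1"
    using coset_structure[OF S _ m] bnd by metis
  let ?M = "filter_mset (\<lambda>p. fst p = a) S" and ?K = "filter_mset (\<lambda>p. fst p \<noteq> a) S"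
  have SMK: "S = ?M + ?K" by (rule multiset_partition)
  have bnd': "(fst p = 0 \<or> fst p = a) \<and> 0 \<le> snd p \<and> snd p < int n" if "p \<in># S" for p
    using a(4) bnd that by blast
  obtain j where j: "size ?M + 1 = m * j" using a(5) by (rule dvdE)
  then have "j > 0" by (cases j) auto
  show ?thesis
  proof (cases "j = 1")
    case True
    then have sM: "size ?M = m - 1" using j by simp
    then have sK: "size ?K = n - 1"
    proof -
      have "size S = size ?M + size ?K" using SMK by (metis size_union)
      then show ?thesis using S(2) sM m n_pos by linarith
    qed
    have bK: "fst p = 0 \<and> 0 \<le> snd p \<and> snd p < int n" if "p \<in># ?K" for p
      using bnd'[of p] that by simp
    have "pof ?K" using S(1) pof_mono multiset_filter_subset by blast
    then obtain c where "coprime c n" "?K = replicate_mset (n - 1) (0, int c)"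
      using cyclic_classification[OF _ sK bK] by blast
    then show ?thesis using a(1) sM SMK by (metis (mono_tags, lifting) mem_Collect_eq set_mset_filter)
  next
    case False
    then have "m * 2 \<le> m * j" using \<open>j > 0\<close> by (intro mult_le_mono2) simp
    then have N: "size ?M \<ge> 2 * m - 1" using j by linarith
    then have m2: "m = 2" using coset_excess[OF m S bnd' a(1,5)] by blast
    then have "a = 1" using a by simp
    then show ?thesis
      using dihedral_excess[OF m2 S] bnd' a(5) N m2 by (intro disjI2) simp
  qed
qed

end

section \<open>Normal forms in the presented group\<close>

context frobenius_pairs
begin

text \<open>By \<open>elt_eq_iff\<close> below, this is equality of the group elements that two
  unreduced pairs represent.\<close>

definition pcong :: "nat \<times> int \<Rightarrow> nat \<times> int \<Rightarrow> bool" where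
  "pcong p q \<longleftrightarrow> [fst p = fst q] (mod m) \<and> [snd p = snd q] (mod int n)"

lemma pcong_refl [simp]: "pcong p p"
  and pcong_sym: "pcong p q \<Longrightarrow> pcong q p"
  and pcong_trans: "pcong p q \<Longrightarrow> pcong q r \<Longrightarrow> pcong p r"
  by (auto simp: pcong_def intro: cong_sym cong_trans)

lemma s_pow_cong:
  assumes "[k = l] (mod m)"
  shows "[s ^ k = s ^ l] (mod int n)"
proof -
  have "[s ^ k = s ^ (k mod m)] (mod int n)" for k
  proof -
    have "[s ^ (m * (k div m)) * s ^ (k mod m) = 1 * s ^ (k mod m)] (mod int n)"
      by (intro cong_mult s_pow_dvd) auto
    then show ?thesis by (simp flip: power_add)
  qed
  from this[of k] this[of l] show ?thesis
    using assms unfolding cong_def by metis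
qed

lemma pcong_pmul: "pcong p p' \<Longrightarrow> pcong q q' \<Longrightarrow> pcong (pmul p q) (pmul p' q')"
  by (auto simp: pcong_def pmul_def intro!: cong_add cong_mult s_pow_cong)

lemma pprod_append_pmul: "pprod (ps @ qs) = pmul (pprod ps) (pprod qs)"
  by (simp add: pprod_append pmul_def)

section \<open>Evaluation of words as pairs\<close>

text \<open>The inverse of x is written as x^(m - 1) because first components are natural
  numbers.\<close>

fun letter_pair :: "gens letter \<Rightarrow> nat \<times> int" where
  "letter_pair (Gen X) = (1, 0)"
| "letter_pair (Gen Y) = (0, 1)"
| "letter_pair (Inv X) = (m - 1, 0)"
| "letter_pair (Inv Y) = (0, - 1)"

definition word_pair :: "gens word \<Rightarrow> nat \<times> int" where
  "word_pair w = pprod (map letter_pair w)"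

lemma word_pair_Nil [simp]: "word_pair [] = (0, 0)"
  and word_pair_Cons: "word_pair (a # w) = pmul (letter_pair a) (word_pair w)"
  and word_pair_append: "word_pair (u @ v) = pmul (word_pair u) (word_pair v)"
  by (simp_all add: word_pair_def pprod_append_pmul pmul_def)

lemma pmul_zero [simp]: "pmul (0, 0) p = p" "pmul p (0, 0) = p"
  by (simp_all add: pmul_def)

lemma word_pair_powers:
  "word_pair (replicate k (Gen X)) = (k, 0)"
  "word_pair (replicate k (Gen Y)) = (0, int k)"
  "word_pair (replicate k (Inv Y)) = (0, - int k)"
  by (induction k) (auto simp: word_pair_Cons pmul_def)

lemma word_pair_relation:
  assumes "(l, r) \<in> metacyclic_relations m n s"
  shows "pcong (word_pair l) (word_pair r)"
proof -
  consider "l = word_power [Gen X] (int m)" "r = []" | "l = word_power [Gen Y] (int n)" "r = []"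
    | "l = [Inv X, Gen Y, Gen X]" "r = word_power [Gen Y] s"
    using assms by (auto simp: metacyclic_relations_def)
  then show ?thesis
  proof cases
    case 3
    have "word_pair r = (0, s)"
      using 3 by (simp add: word_power_def inv_word_def word_pair_powers)
    then show ?thesis
      using 3 m_pos by (simp add: word_pair_Cons pmul_def pcong_def cong_0_iff)
  qed (auto simp: word_power_def word_pair_powers pcong_def cong_0_iff)
qed

text \<open>Evaluation is an invariant of the presentation: incongruent pairs come from distinct
  group elements, so the relations cause no further collapse.\<close>

lemma word_pair_cong:
  "pres_eq (metacyclic_relations m n s) u v \<Longrightarrow> pcong (word_pair u) (word_pair v)"
proof (induction rule: pres_eq.induct)
  case (cancel u a v)
  have "pcong (word_pair [a, inv_letter a]) (0, 0)"
  proof (cases a)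
    case (Gen g)
    then show ?thesis using m_pos by (cases g) (auto simp: word_pair_Cons pmul_def pcong_def cong_0_iff)
  next
    case (Inv g)
    then show ?thesis using m_pos by (cases g) (auto simp: word_pair_Cons pmul_def pcong_def cong_0_iff)
  qed
  then have "pcong (pmul (word_pair u) (pmul (word_pair [a, inv_letter a]) (word_pair v)))
      (pmul (word_pair u) (pmul (0, 0) (word_pair v)))"
    by (intro pcong_pmul pcong_refl)
  then show ?case by (simp only: word_pair_append pmul_zero)
next
  case (relation l r u v)
  then show ?case
    unfolding word_pair_append by (intro pcong_pmul pcong_refl word_pair_relation)
qed (auto intro: pcong_sym pcong_trans)

section \<open>Calculation with the generators of the presented group\<close>

abbreviation G where "G \<equiv> metacyclic m n s"
abbreviation x where "x \<equiv> gen_x m n s"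
abbreviation y where "y \<equiv> gen_y m n s"
abbreviation word_class where "word_class \<equiv> pres_class (metacyclic_relations m n s)"

sublocale G: group G
  unfolding metacyclic_def by (rule group_presented_group)

lemma word_class_append: "word_class (u @ v) = word_class u \<otimes>\<^bsub>G\<^esub> word_class v"
  by (simp add: metacyclic_def mult_pres_class)

lemma one_G: "\<one>\<^bsub>G\<^esub> = word_class []"
  and carrier_G: "carrier G = range word_class"
  by (simp_all add: metacyclic_def one_presented_group carrier_presented_group)

lemma x_closed [simp]: "x \<in> carrier G" and y_closed [simp]: "y \<in> carrier G"
  by (simp_all add: carrier_G gen_x_def gen_y_def)

lemma word_class_power: "word_class (replicate k a) = word_class [a] [^]\<^bsub>G\<^esub> k"
proof (induction k)
  case (Suc k)
  have "word_class [a] \<in> carrier G" by (simp add: carrier_G)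
  then show ?case
    using Suc word_class_append[of "[a]" "replicate k a"] by (metis G.nat_pow_Suc2 append_Cons append_Nil replicate_Suc)
qed (simp add: one_G)

lemma word_class_inv: "word_class [Inv g] = inv\<^bsub>G\<^esub> word_class [Gen g]"
proof -
  have "pres_eq (metacyclic_relations m n s) ([] @ [Inv g, inv_letter (Inv g)] @ []) ([] @ [])"
    by (rule pres_eq.cancel)
  then have "word_class [Inv g] \<otimes>\<^bsub>G\<^esub> word_class [Gen g] = \<one>\<^bsub>G\<^esub>"
    by (simp add: one_G pres_class_eq_iff flip: word_class_append)
  then show ?thesis by (simp add: G.inv_equality carrier_G)
qed

lemma word_class_relation:
  "(l, r) \<in> metacyclic_relations m n s \<Longrightarrow> word_class l = word_class r"
  using pres_eq.relation[of l r _ "[]" "[]"] by (simp add: pres_class_eq_iff)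

lemma x_pow_m: "x [^]\<^bsub>G\<^esub> m = \<one>\<^bsub>G\<^esub>"
proof -
  have "word_class (word_power [Gen X] (int m)) = word_class []"
    by (intro word_class_relation) (simp add: metacyclic_relations_def)
  then show ?thesis by (simp add: word_power_def word_class_power one_G gen_x_def)
qed

lemma y_pow_n: "y [^]\<^bsub>G\<^esub> n = \<one>\<^bsub>G\<^esub>"
proof -
  have "word_class (word_power [Gen Y] (int n)) = word_class []"
    by (intro word_class_relation) (simp add: metacyclic_relations_def)
  then show ?thesis by (simp add: word_power_def word_class_power one_G gen_y_def)
qed

lemma y_conj_x: "inv\<^bsub>G\<^esub> x \<otimes>\<^bsub>G\<^esub> y \<otimes>\<^bsub>G\<^esub> x = y [^]\<^bsub>G\<^esub> s"
proof -
  have "word_class [Inv X, Gen Y, Gen X] = word_class (word_power [Gen Y] s)"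
    by (intro word_class_relation) (simp add: metacyclic_relations_def)
  also have "\<dots> = y [^]\<^bsub>G\<^esub> s"
  proof (cases "s \<ge> 0")
    case True
    then have "word_power [Gen Y] s = replicate (nat s) (Gen Y)"
      by (simp add: word_power_def)
    then have "word_class (word_power [Gen Y] s) = y [^]\<^bsub>G\<^esub> nat s"
      by (simp only: word_class_power gen_y_def)
    also have "\<dots> = y [^]\<^bsub>G\<^esub> s"
      using True by (metis int_pow_int nat_0_le)
    finally show ?thesis .
  next
    case False
    then have "word_power [Gen Y] s = replicate (nat (- s)) (Inv Y)"
      by (simp add: word_power_def inv_word_def)
    then have "word_class (word_power [Gen Y] s) = (inv\<^bsub>G\<^esub> y) [^]\<^bsub>G\<^esub> nat (- s)"
      by (simp only: word_class_power word_class_inv gen_y_def)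
    also have "\<dots> = y [^]\<^bsub>G\<^esub> s"
      using False by (simp only: int_pow_def2 G.nat_pow_inv y_closed if_True not_le)
    finally show ?thesis .
  qed
  also have "word_class [Inv X, Gen Y, Gen X] = inv\<^bsub>G\<^esub> x \<otimes>\<^bsub>G\<^esub> y \<otimes>\<^bsub>G\<^esub> x"
    using word_class_append[of "[Inv X, Gen Y]" "[Gen X]"] word_class_append[of "[Inv X]" "[Gen Y]"]
    by (simp add: word_class_inv gen_x_def gen_y_def)
  finally show ?thesis .
qed

text \<open>Conjugation by x is a homomorphism, so the relation for y passes to all integer powers
  of y.\<close>

lemma y_pow_x: "y [^]\<^bsub>G\<^esub> (j :: int) \<otimes>\<^bsub>G\<^esub> x = x \<otimes>\<^bsub>G\<^esub> y [^]\<^bsub>G\<^esub> (j * s)"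
proof -
  let ?c = "\<lambda>g. inv\<^bsub>G\<^esub> x \<otimes>\<^bsub>G\<^esub> g \<otimes>\<^bsub>G\<^esub> x"
  have "?c \<in> hom G G"
  proof (rule homI)
    fix g h assume "g \<in> carrier G" "h \<in> carrier G"
    then show "?c (g \<otimes>\<^bsub>G\<^esub> h) = ?c g \<otimes>\<^bsub>G\<^esub> ?c h"
      by (simp add: G.m_assoc) (simp add: G.inv_solve_left flip: G.m_assoc)
  qed auto
  then have "?c (y [^]\<^bsub>G\<^esub> j) = (?c y) [^]\<^bsub>G\<^esub> j"
    using hom_int_pow[of ?c G G y j] G.group_axioms by simp
  also have "\<dots> = y [^]\<^bsub>G\<^esub> (j * s)"
    by (simp add: y_conj_x G.int_pow_pow mult.commute)
  finally show ?thesis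
    by (metis G.inv_solve_left G.int_pow_closed G.m_assoc G.m_closed G.inv_closed x_closed y_closed)
qed

lemma y_pow_x_pow:
  "y [^]\<^bsub>G\<^esub> (j :: int) \<otimes>\<^bsub>G\<^esub> x [^]\<^bsub>G\<^esub> (k :: nat) = x [^]\<^bsub>G\<^esub> k \<otimes>\<^bsub>G\<^esub> y [^]\<^bsub>G\<^esub> (j * s ^ k)"
proof (induction k)
  case (Suc k)
  have "y [^]\<^bsub>G\<^esub> j \<otimes>\<^bsub>G\<^esub> x [^]\<^bsub>G\<^esub> Suc k = (y [^]\<^bsub>G\<^esub> j \<otimes>\<^bsub>G\<^esub> x [^]\<^bsub>G\<^esub> k) \<otimes>\<^bsub>G\<^esub> x"
    by (simp add: G.m_assoc)
  also have "\<dots> = x [^]\<^bsub>G\<^esub> k \<otimes>\<^bsub>G\<^esub> (y [^]\<^bsub>G\<^esub> (j * s ^ k) \<otimes>\<^bsub>G\<^esub> x)"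
    by (simp add: Suc G.m_assoc)
  also have "\<dots> = x [^]\<^bsub>G\<^esub> Suc k \<otimes>\<^bsub>G\<^esub> y [^]\<^bsub>G\<^esub> (j * s ^ k * s)"
    by (simp add: y_pow_x flip: G.m_assoc)
  finally show ?case by (simp add: mult_ac)
qed simp

section \<open>The normal form x^i y^j\<close>

definition elt :: "nat \<times> int \<Rightarrow> gens word set" where
  "elt p = x [^]\<^bsub>G\<^esub> fst p \<otimes>\<^bsub>G\<^esub> y [^]\<^bsub>G\<^esub> snd p"

lemma elt_closed [simp]: "elt p \<in> carrier G"
  by (simp add: elt_def)

lemma elt_pmul: "elt (pmul p q) = elt p \<otimes>\<^bsub>G\<^esub> elt q"
proof -
  obtain i j k l where [simp]: "p = (i, j)" "q = (k, l)" by (cases p, cases q)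
  have "elt p \<otimes>\<^bsub>G\<^esub> elt q = x [^]\<^bsub>G\<^esub> i \<otimes>\<^bsub>G\<^esub> (y [^]\<^bsub>G\<^esub> j \<otimes>\<^bsub>G\<^esub> x [^]\<^bsub>G\<^esub> k) \<otimes>\<^bsub>G\<^esub> y [^]\<^bsub>G\<^esub> l"
    by (simp add: elt_def G.m_assoc)
  also have "\<dots> = (x [^]\<^bsub>G\<^esub> i \<otimes>\<^bsub>G\<^esub> x [^]\<^bsub>G\<^esub> k) \<otimes>\<^bsub>G\<^esub> (y [^]\<^bsub>G\<^esub> (j * s ^ k) \<otimes>\<^bsub>G\<^esub> y [^]\<^bsub>G\<^esub> l)"
    by (simp add: y_pow_x_pow G.m_assoc)
  also have "\<dots> = elt (pmul p q)"
    by (simp add: elt_def pmul_def G.nat_pow_mult G.int_pow_mult)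
  finally show ?thesis ..
qed

lemma elt_cong:
  assumes "pcong p q"
  shows "elt p = elt q"
proof -
  have x: "x [^]\<^bsub>G\<^esub> i = x [^]\<^bsub>G\<^esub> (i mod m)" for i
  proof -
    have "x [^]\<^bsub>G\<^esub> (m * (i div m) + i mod m) = x [^]\<^bsub>G\<^esub> (i mod m)"
      by (simp only: G.nat_pow_mult[symmetric] G.nat_pow_pow[symmetric] x_closed x_pow_m G.nat_pow_one
          G.nat_pow_closed G.l_one)
    then show ?thesis by simp
  qed
  have y: "y [^]\<^bsub>G\<^esub> j = y [^]\<^bsub>G\<^esub> (j mod int n)" for j :: int
  proof -
    have "y [^]\<^bsub>G\<^esub> (int n * (j div int n) + j mod int n) = y [^]\<^bsub>G\<^esub> (j mod int n)"
      by (simp only: G.int_pow_mult G.int_pow_pow[symmetric] y_closed int_pow_int y_pow_n G.int_pow_one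
          G.int_pow_closed G.l_one)
    then show ?thesis by simp
  qed
  show ?thesis
    using assms unfolding elt_def pcong_def cong_def by (metis x y)
qed

text \<open>Every word reduces to its normal form. This complements \<open>word_pair_cong\<close>,
  which keeps incongruent normal forms apart.\<close>

lemma word_class_eq_elt: "word_class w = elt (word_pair w)"
proof (induction w)
  case Nil
  show ?case by (simp add: elt_def flip: one_G)
next
  case (Cons a w)
  have "word_class [a] = elt (letter_pair a)"
  proof (cases a)
    case (Gen g)
    then show ?thesis by (cases g) (simp_all add: elt_def flip: gen_x_def gen_y_def)
  next
    case (Inv g)
    show ?thesis
    proof (cases g)
      case X
      have "x [^]\<^bsub>G\<^esub> (m - 1) \<otimes>\<^bsub>G\<^esub> x = \<one>\<^bsub>G\<^esub>"
        using x_pow_m m_pos by (metis G.nat_pow_Suc Suc_diff_1)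
      then have "inv\<^bsub>G\<^esub> x = x [^]\<^bsub>G\<^esub> (m - 1)" by (simp add: G.inv_equality)
      then show ?thesis by (simp add: Inv X word_class_inv elt_def flip: gen_x_def)
    next
      case Y
      then show ?thesis by (simp add: Inv word_class_inv elt_def G.int_pow_neg flip: gen_y_def)
    qed
  qed
  then show ?case
    using word_class_append[of "[a]" w] Cons by (simp add: word_pair_Cons elt_pmul)
qed

lemma word_pair_surj: "\<exists>w. pcong (word_pair w) p"
proof -
  obtain i j where p: "p = (i, j)" by (cases p)
  let ?w = "replicate i (Gen X) @ replicate (nat (j mod int n)) (Gen Y)"
  have "word_pair ?w = (i, j mod int n)"
    using n_pos by (simp only: word_pair_append word_pair_powers pmul_def) simp
  then have "pcong (word_pair ?w) p" by (simp add: pcong_def p)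
  then show ?thesis by blast
qed

lemma elt_eq_iff: "elt p = elt q \<longleftrightarrow> pcong p q"
proof
  assume eq: "elt p = elt q"
  obtain u v where u: "pcong (word_pair u) p" and v: "pcong (word_pair v) q"
    using word_pair_surj by metis
  then have "word_class u = word_class v"
    using eq by (simp add: word_class_eq_elt elt_cong)
  then have "pcong (word_pair u) (word_pair v)"
    by (simp add: pres_class_eq_iff word_pair_cong)
  with u v show "pcong p q" by (meson pcong_sym pcong_trans)
qed (rule elt_cong)

text \<open>A solution of the word problem, used in \<open>metacyclic_2_3\<close> to compare the
  presentations for different \<open>s\<close>.\<close>

lemma pres_eq_iff: "pres_eq (metacyclic_relations m n s) u v \<longleftrightarrow> pcong (word_pair u) (word_pair v)"
  by (simp add: word_class_eq_elt elt_eq_iff flip: pres_class_eq_iff)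

lemma one_eq_elt: "\<one>\<^bsub>G\<^esub> = elt (0, 0)"
  by (simp add: elt_def)

lemma elt_eq_one_iff: "elt p = \<one>\<^bsub>G\<^esub> \<longleftrightarrow> m dvd fst p \<and> int n dvd snd p"
  by (simp add: one_eq_elt elt_eq_iff pcong_def cong_0_iff)

lemma foldr_elt: "foldr (\<otimes>\<^bsub>G\<^esub>) (map elt ps) \<one>\<^bsub>G\<^esub> = elt (pprod ps)"
  by (induction ps) (simp_all add: one_eq_elt pprod_def elt_pmul)

section \<open>Transfer between group elements and reduced pairs\<close>

definition pair_of :: "gens word set \<Rightarrow> nat \<times> int" where
  "pair_of g = (THE p. elt p = g \<and> fst p < m \<and> 0 \<le> snd p \<and> snd p < int n)"

lemma pair_of_elt: "pair_of (elt p) = (fst p mod m, snd p mod int n)"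
  unfolding pair_of_def
proof (rule the_equality)
  show "elt (fst p mod m, snd p mod int n) = elt p \<and> fst (fst p mod m, snd p mod int n) < m \<and>
      0 \<le> snd (fst p mod m, snd p mod int n) \<and> snd (fst p mod m, snd p mod int n) < int n"
    using m_pos n_pos by (simp add: elt_eq_iff pcong_def)
  fix q assume "elt q = elt p \<and> fst q < m \<and> 0 \<le> snd q \<and> snd q < int n"
  then show "q = (fst p mod m, snd p mod int n)"
    by (auto simp: elt_eq_iff pcong_def cong_def prod_eq_iff)
qed

lemma carrier_eq_elt: "carrier G = range elt"
proof
  show "carrier G \<subseteq> range elt" by (auto simp: carrier_G word_class_eq_elt)
qed auto

lemma elt_pair_of:
  assumes "g \<in> carrier G"
  shows "elt (pair_of g) = g"
proof -
  obtain p where "g = elt p" using assms by (auto simp: carrier_eq_elt)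
  moreover have "pcong (fst p mod m, snd p mod int n) p" by (simp add: pcong_def)
  ultimately show ?thesis by (simp add: pair_of_elt elt_cong)
qed

lemma pair_of_bounds: "g \<in> carrier G \<Longrightarrow> fst (pair_of g) < m \<and> 0 \<le> snd (pair_of g) \<and> snd (pair_of g) < int n"
  using m_pos n_pos by (auto simp: carrier_eq_elt pair_of_elt)

lemma image_elt_pair_of: "seq_over G S \<Longrightarrow> image_mset elt (image_mset pair_of S) = S"
  by (induction S) (auto simp: seq_over_def elt_pair_of)

text \<open>Orderings correspond under \<open>elt\<close> and \<open>pair_of\<close>, and
  \<open>foldr_elt\<close> identifies the product of an ordering with \<open>pprod\<close>.\<close>

lemma product_one_free_iff:
  assumes "seq_over G S"
  shows "product_one_free G S \<longleftrightarrow> pof (image_mset pair_of S)"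
proof
  assume free: "product_one_free G S"
  show "pof (image_mset pair_of S)"
    unfolding pof_def
  proof (intro allI impI notI)
    fix ps assume ps: "mset ps \<subseteq># image_mset pair_of S" "ps \<noteq> []" "m dvd fst (pprod ps)" "int n dvd snd (pprod ps)"
    have "mset (map elt ps) \<subseteq># S"
      using image_mset_subseteq_mono[OF ps(1), of elt] image_elt_pair_of[OF assms] by simp
    moreover have "product_one G (mset (map elt ps))"
      unfolding product_one_def using ps by (intro exI[of _ "map elt ps"]) (simp add: foldr_elt elt_eq_one_iff)
    ultimately show False using free ps(2) by (auto simp: product_one_free_def)
  qed
next
  assume pof: "pof (image_mset pair_of S)"
  show "product_one_free G S"
    unfolding product_one_free_def
  proof (intro allI impI notI)
    fix T assume T: "T \<subseteq># S \<and> T \<noteq> {#}" and "product_one G T"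
    then obtain gs where gs: "mset gs = T" "foldr (\<otimes>\<^bsub>G\<^esub>) gs \<one>\<^bsub>G\<^esub> = \<one>\<^bsub>G\<^esub>"
      by (auto simp: product_one_def)
    define ps where "ps = map pair_of gs"
    have "set gs \<subseteq> carrier G"
      using assms T gs(1) unfolding seq_over_def by (metis set_mset_mono set_mset_mset subset_trans)
    then have "map elt ps = gs"
      by (auto simp: ps_def elt_pair_of intro!: map_idI)
    then have "elt (pprod ps) = \<one>\<^bsub>G\<^esub>" using gs(2) foldr_elt by metis
    moreover have "mset ps \<subseteq># image_mset pair_of S"
      using T gs(1) by (auto simp: ps_def intro: image_mset_subseteq_mono)
    moreover have "ps \<noteq> []" using T gs(1) by (auto simp: ps_def)
    ultimately show False using pof by (auto simp: pof_def elt_eq_one_iff)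
  qed
qed

lemma card_carrier: "card (carrier G) = m * n"
proof -
  have "bij_betw elt ({..<m} \<times> {0..<int n}) (carrier G)"
  proof (rule bij_betw_byWitness[where f' = pair_of])
    show "\<forall>p\<in>{..<m} \<times> {0..<int n}. pair_of (elt p) = p"
      by (auto simp: pair_of_elt)
    show "\<forall>g\<in>carrier G. elt (pair_of g) = g" by (simp add: elt_pair_of)
    show "elt ` ({..<m} \<times> {0..<int n}) \<subseteq> carrier G" by auto
    show "pair_of ` carrier G \<subseteq> {..<m} \<times> {0..<int n}"
      using pair_of_bounds by (intro image_subsetI) (simp add: mem_Times_iff)
  qed
  then have "card ({..<m} \<times> {0..<int n}) = card (carrier G)" by (rule bij_betw_same_card)
  then show ?thesis by (simp add: card_cartesian_product)
qed


section \<open>The listed sequences, the classification in the group and the small Davenport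
  constant\<close>

text \<open>A product in the normal subgroup uses k < m terms of \<open>M\<close> with m dividing k
  a, so k = 0. What remains is l < n copies of c with n dividing l c, so l = 0.\<close>

lemma pof_standard:
  assumes a: "coprime a m" and c: "coprime c (int n)" and M: "size M = m - 1" "\<forall>p\<in>#M. fst p = a"
  shows "pof (M + replicate_mset (n - 1) (0, c))"
  unfolding pof_def
proof (intro allI impI notI)
  let ?R = "replicate_mset (n - 1) (0 :: nat, c)"
  fix ps assume ps: "mset ps \<subseteq># M + ?R" "ps \<noteq> []" "m dvd fst (pprod ps)" "int n dvd snd (pprod ps)"
  let ?U = "mset ps"
  have R: "?U - M \<subseteq># ?R" using ps(1) by (simp add: subset_eq_diff_conv add.commute)
  have U: "(?U - M) + (?U \<inter># M) = ?U" by (simp add: inter_mset_def)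
  have "deg V = size V * a" if "V \<subseteq># M" for V
  proof -
    have "\<forall>p\<in>#V. fst p = a" using M(2) mset_subset_eqD[OF that] by simp
    then show ?thesis by (induction V) auto
  qed
  from this[of "?U \<inter># M"] have "deg (?U \<inter># M) = size (?U \<inter># M) * a" by simp
  moreover have R0: "p \<in># ?U - M \<Longrightarrow> p = (0, c)" for p
    using mset_subset_eqD[OF R, of p] by (simp split: if_splits)
  have "fst p = 0" if "p \<in># ?U - M" for p using R0[OF that] by simp
  then have "deg (?U - M) = 0" by (simp add: deg_def)
  moreover have "fst (pprod ps) = deg (?U - M) + deg (?U \<inter># M)"
    using U deg_add[of "?U - M" "?U \<inter># M"] by (simp add: fst_pprod)
  ultimately have "m dvd size (?U \<inter># M) * a" using ps(3) by simp
  then have "m dvd size (?U \<inter># M)" using a by (metis coprime_commute coprime_dvd_mult_left_iff)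
  moreover have "size (?U \<inter># M) \<le> size M" by (intro size_mset_mono) simp
  then have "size (?U \<inter># M) < m" using M(1) m_pos by simp
  ultimately have "?U \<inter># M = {#}" using nat_dvd_not_less by fastforce
  then have UR: "?U - M = ?U" using U by simp
  have "p = (0, c)" if "p \<in> set ps" for p
    using R0[of p] that UR by simp
  then have "ps = replicate (length ps) (0, c)"
    by (simp add: replicate_length_same)
  then obtain l where l: "ps = replicate l (0, c)" by blast
  have "pprod ps = (0, int l * c)" unfolding l by (induction l) (auto simp: algebra_simps)
  then have "int n dvd int l * c" using ps(4) by simp
  then have "n dvd l" using c by (metis coprime_commute coprime_dvd_mult_left_iff int_dvd_int_iff)
  moreover have "l \<le> n - 1" using size_mset_mono[OF R] UR l by simp
  moreover have "l > 0" using ps(2) l by auto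
  ultimately show False using n_pos nat_dvd_not_less by auto
qed

lemma elt_nat: "elt (i, int j) = x [^]\<^bsub>G\<^esub> i \<otimes>\<^bsub>G\<^esub> y [^]\<^bsub>G\<^esub> j"
  by (simp add: elt_def int_pow_int)

lemma standard_eq_image_elt:
  "image_mset (\<lambda>i. x [^]\<^bsub>G\<^esub> a \<otimes>\<^bsub>G\<^esub> y [^]\<^bsub>G\<^esub> b i) I + replicate_mset k (y [^]\<^bsub>G\<^esub> (c :: nat)) =
    image_mset elt (image_mset (\<lambda>i. (a, int (b i))) I + replicate_mset k (0, int c))"
  by (simp add: multiset.map_comp o_def elt_nat)

lemma exceptional_eq_image_elt:
  "{#x, x \<otimes>\<^bsub>G\<^esub> y, x \<otimes>\<^bsub>G\<^esub> y [^]\<^bsub>G\<^esub> (2 :: nat)#} = image_mset elt {#(1, 0), (1, 1), (1, 2)#}"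
  using elt_nat[of 1 0] elt_nat[of 1 1] elt_nat[of 1 2] by simp

lemma product_one_free_image_elt:
  "product_one_free G (image_mset elt S) \<longleftrightarrow> pof (image_mset (\<lambda>p. (fst p mod m, snd p mod int n)) S)"
proof -
  have "seq_over G (image_mset elt S)" by (auto simp: seq_over_def)
  then show ?thesis by (simp add: product_one_free_iff multiset.map_comp o_def pair_of_elt)
qed

lemma standard_product_one_free:
  fixes a c :: nat and b :: "nat \<Rightarrow> nat"
  assumes "gcd a m = 1" "gcd c n = 1"
  shows "product_one_free G (image_mset (\<lambda>i. x [^]\<^bsub>G\<^esub> a \<otimes>\<^bsub>G\<^esub> y [^]\<^bsub>G\<^esub> b i) (mset_set {1..m - 1})
           + replicate_mset (n - 1) (y [^]\<^bsub>G\<^esub> (c :: nat)))"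
proof -
  have "coprime a m" "coprime c n" using assms by (simp_all only: coprime_iff_gcd_eq_1)
  then have "coprime (a mod m) m" "coprime (int c mod int n) (int n)"
    using m_pos n_pos by (simp_all add: coprime_mod_left_iff)
  then have "pof (image_mset (\<lambda>i. (a mod m, int (b i) mod int n)) (mset_set {1..m - 1})
      + replicate_mset (n - 1) (0, int c mod int n))"
    by (intro pof_standard[where a = "a mod m"]) auto
  then show ?thesis
    unfolding standard_eq_image_elt product_one_free_image_elt
    by (simp add: multiset.map_comp o_def)
qed

lemma s_cong_minus_one:
  assumes "m = 2" "n = 3"
  shows "[s = -1] (mod 3)"
proof -
  have "int 3 dvd (s - 1) * (s + 1)"
    using s_pow assms by (simp add: cong_iff_dvd_diff power2_eq_square algebra_simps)
  moreover have "coprime (s - 1) (int 3)" using s_unit[of 1] assms by simp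
  ultimately show ?thesis
    by (simp add: cong_iff_dvd_diff coprime_commute coprime_dvd_mult_right_iff)
qed

text \<open>Every term has degree 1, so a nonempty product of even degree has exactly two factors.
  They are distinct, and since \<open>s\<close> is -1 modulo 3 the exponent is their nonzero
  difference.\<close>

lemma exceptional_product_one_free:
  assumes "m = 2" "n = 3"
  shows "product_one_free G {#x, x \<otimes>\<^bsub>G\<^esub> y, x \<otimes>\<^bsub>G\<^esub> y [^]\<^bsub>G\<^esub> (2 :: nat)#}"
proof -
  let ?E = "{#(1, 0), (1, 1), (1, 2)#} :: (nat \<times> int) multiset"
  have "pof ?E"
    unfolding pof_def
  proof (intro allI impI notI)
    fix ps assume ps: "mset ps \<subseteq># ?E" "ps \<noteq> []" "m dvd fst (pprod ps)" "int n dvd snd (pprod ps)"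
    have one: "p \<in> {(1, 0), (1, 1), (1, 2)}" if "p \<in> set ps" for p
      using mset_subset_eqD[OF ps(1), of p] that by auto
    then have "fst p = 1" if "p \<in> set ps" for p using that by fastforce
    then have "fst (pprod ps) = length ps" by (induction ps) auto
    moreover have "length ps \<le> 3" using size_mset_mono[OF ps(1)] by simp
    ultimately have "length ps = 2"
      using ps(2,3) assms(1) by (cases "length ps") (auto simp: le_Suc_eq numeral_3_eq_3)
    then obtain p q where pq: "ps = [p, q]" by (auto simp: length_Suc_conv numeral_2_eq_2)
    have "p \<noteq> q"
    proof
      assume "p = q"
      with pq ps(1) have "2 \<le> count ?E p" using mset_subset_eq_count[OF ps(1), of p] by simp
      then show False by (auto split: if_splits)
    qed
    have "[snd p * s + snd q = snd p * (-1) + snd q] (mod 3)"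
      by (intro cong_add cong_mult s_cong_minus_one assms) auto
    moreover have "fst q = 1" using one[of q] pq by auto
    then have "3 dvd snd p * s + snd q" using ps(4) pq assms by simp
    ultimately have "3 dvd snd p * (-1) + snd q" by (simp add: cong_dvd_iff)
    then show False using one[of p] one[of q] \<open>p \<noteq> q\<close> pq by auto
  qed
  moreover have "image_mset (\<lambda>p. (fst p mod m, snd p mod int n)) ?E = ?E"
    using assms by simp
  ultimately show ?thesis by (simp only: exceptional_eq_image_elt product_one_free_image_elt)
qed

lemma product_one_free_cases:
  assumes S: "seq_over G S" "size S = m + n - 2" "product_one_free G S"
  shows "(\<exists>(a::nat) (c::nat) (b::nat \<Rightarrow> nat). gcd a m = 1 \<and> gcd c n = 1 \<and>
             S = image_mset (\<lambda>i. x [^]\<^bsub>G\<^esub> a \<otimes>\<^bsub>G\<^esub> y [^]\<^bsub>G\<^esub> b i) (mset_set {1..m - 1})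
                 + replicate_mset (n - 1) (y [^]\<^bsub>G\<^esub> c)) \<or>
         (m = 2 \<and> n = 3 \<and> S = {#x, x \<otimes>\<^bsub>G\<^esub> y, x \<otimes>\<^bsub>G\<^esub> y [^]\<^bsub>G\<^esub> (2 :: nat)#})"
proof -
  define P where "P = image_mset pair_of S"
  have SP: "S = image_mset elt P" using image_elt_pair_of[OF S(1)] by (simp add: P_def)
  have bnd: "fst p < m \<and> 0 \<le> snd p \<and> snd p < int n" if "p \<in># P" for p
    using that S(1) pair_of_bounds by (auto simp: P_def seq_over_def)
  have "pof P" "size P = m + n - 2" using S product_one_free_iff by (simp_all add: P_def)
  from pof_classification[OF this bnd]
  consider a c M where "coprime a m" "coprime c n" "size M = m - 1" "\<forall>p\<in>#M. fst p = a"
      "P = M + replicate_mset (n - 1) (0, int c)"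
    | "m = 2" "n = 3" "P = {#(1, 0), (1, 1), (1, 2)#}"
    by blast
  then show ?thesis
  proof cases
    case 1
    obtain ps where ps: "mset ps = M" using ex_mset by blast
    \<comment> \<open>The sequence is indexed from 1 and the list from 0, hence the shift.\<close>
    define b where "b i = nat (snd (ps ! (i - 1)))" for i
    have len: "length ps = m - 1" using 1(3) ps by (metis size_mset)
    have "map (\<lambda>i. (a, int (b i))) [1..<m] = ps"
    proof (rule nth_equalityI)
      fix i assume "i < length (map (\<lambda>i. (a, int (b i))) [1..<m])"
      then have i: "i < length ps" using len by simp
      then have "ps ! i \<in># M" using ps by (metis nth_mem set_mset_mset)
      then have "fst (ps ! i) = a" "0 \<le> snd (ps ! i)" using 1(4,5) bnd by auto
      then show "map (\<lambda>i. (a, int (b i))) [1..<m] ! i = ps ! i"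
        using i len by (simp add: b_def prod_eq_iff)
    qed (simp add: len)
    then have "M = image_mset (\<lambda>i. (a, int (b i))) (mset [1..<m])"
      using ps by (metis mset_map)
    moreover have "mset [1..<m] = mset_set {1..m - 1}"
    proof -
      have "{1..<m} = {1..m - 1}" using m_pos by auto
      then show ?thesis by (metis mset_upt)
    qed
    ultimately have "S = image_mset (\<lambda>i. x [^]\<^bsub>G\<^esub> a \<otimes>\<^bsub>G\<^esub> y [^]\<^bsub>G\<^esub> b i) (mset_set {1..m - 1})
                 + replicate_mset (n - 1) (y [^]\<^bsub>G\<^esub> c)"
      unfolding standard_eq_image_elt SP 1(5) by simp
    moreover have "gcd a m = 1" "gcd c n = 1" using 1(1,2) by (simp_all only: coprime_iff_gcd_eq_1)
    ultimately show ?thesis by (intro disjI1 exI[of _ a] exI[of _ c] exI[of _ b]) simp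
  next
    case 2
    have "S = {#x, x \<otimes>\<^bsub>G\<^esub> y, x \<otimes>\<^bsub>G\<^esub> y [^]\<^bsub>G\<^esub> (2 :: nat)#}"
      by (simp only: SP 2(3) exceptional_eq_image_elt)
    with 2(1,2) show ?thesis by blast
  qed
qed

lemma small_davenport_eq: "small_davenport G = m + n - 2"
  unfolding small_davenport_def
proof (rule Greatest_equality)
  \<comment> \<open>The witness for the lower bound is m - 1 copies of x and n - 1 copies of y; the
    upper bound is \<open>pof_size_le\<close>.\<close>
  let ?S = "image_mset (\<lambda>i. x [^]\<^bsub>G\<^esub> (1::nat) \<otimes>\<^bsub>G\<^esub> y [^]\<^bsub>G\<^esub> (0::nat)) (mset_set {1..m - 1})
           + replicate_mset (n - 1) (y [^]\<^bsub>G\<^esub> (1 :: nat))"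
  have "product_one_free G ?S"
    using standard_product_one_free[of 1 1 "\<lambda>_. 0"] by simp
  moreover have "seq_over G ?S" by (auto simp: seq_over_def)
  moreover have "size ?S = m + n - 2" using m_pos n_pos by simp
  ultimately show "\<exists>S. seq_over G S \<and> product_one_free G S \<and> size S = m + n - 2" by blast
  show "l \<le> m + n - 2" if "\<exists>S. seq_over G S \<and> product_one_free G S \<and> size S = l" for l
    using that pof_size_le product_one_free_iff by (metis size_image_mset)
qed

section \<open>Recognising the exceptional group\<close>

lemma comm_group_if_degenerate:
  assumes "m = 1 \<or> n = 1"
  shows "comm_group G"
proof (rule G.group_comm_groupI)
  fix g h assume "g \<in> carrier G" "h \<in> carrier G"
  then obtain p q where [simp]: "g = elt p" "h = elt q" by (auto simp: carrier_eq_elt)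
  have pow: "[j * s ^ k = j] (mod int n)" for j k
    using assms
  proof
    assume "m = 1"
    then have "[j * s ^ k = j * 1] (mod int n)" by (intro cong_mult s_pow_dvd) auto
    then show ?thesis by simp
  qed (simp add: cong_def)
  have "[snd p * s ^ fst q + snd q = snd p + snd q] (mod int n)"
    by (intro cong_add pow) simp
  moreover have "[snd p + snd q = snd p + snd q * s ^ fst p] (mod int n)"
    by (intro cong_add cong_sym[OF pow]) simp
  ultimately have "pcong (pmul p q) (pmul q p)"
    by (auto simp: pcong_def pmul_def add.commute intro: cong_trans)
  then show "g \<otimes>\<^bsub>G\<^esub> h = h \<otimes>\<^bsub>G\<^esub> g" by (simp add: elt_eq_iff flip: elt_pmul)
qed

end

lemma frobenius_pairs_2_3:
  assumes "[s = -1] (mod 3)"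
  shows "frobenius_pairs 2 3 s"
proof
  have "[s ^ 2 = (-1) ^ 2] (mod 3)" using assms by (rule cong_pow)
  then show "[s ^ 2 = 1] (mod int 3)" by simp
  fix i :: nat assume "0 < i" "i < 2"
  then have "i = 1" by simp
  have "[-1 - 1 = s - 1] (mod 3)" using assms by (intro cong_diff cong_sym[OF assms]) simp
  moreover have "coprime (-1 - 1) (3 :: int)" by (simp add: coprime_iff_gcd_eq_1 gcd_non_0_int)
  ultimately show "coprime (s ^ i - 1) (int 3)"
    using cong_imp_coprime \<open>i = 1\<close> by fastforce
qed auto

interpretation G23: frobenius_pairs 2 3 "-1"
  rewrites "metacyclic 2 3 (-1) = G23"
  by (auto intro: frobenius_pairs_2_3 simp: G23_def)

text \<open>The groups are equal and not merely isomorphic: their elements are classes of words, and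
  both congruences are evaluation of words modulo 2 and 3, which depends only on \<open>s\<close>
  modulo 3.\<close>

lemma metacyclic_2_3:
  assumes s: "[s = -1] (mod 3)"
  shows "metacyclic 2 3 s = G23"
proof -
  interpret A: frobenius_pairs 2 3 s by (rule frobenius_pairs_2_3[OF s])
  have fst: "fst (A.word_pair w) = fst (G23.word_pair w)" for w
  proof (induction w)
    case (Cons a w)
    then show ?case
      unfolding A.word_pair_Cons G23.word_pair_Cons A.pmul_def G23.pmul_def fst_conv by (rule arg_cong)
  qed (simp only: A.word_pair_Nil G23.word_pair_Nil)
  have "G23.pcong (A.word_pair w) (G23.word_pair w)" for w
  proof (induction w)
    case (Cons a w)
    have "[snd (G23.letter_pair a) * s ^ fst (G23.word_pair w) + snd (A.word_pair w) =
        snd (G23.letter_pair a) * (-1) ^ fst (G23.word_pair w) + snd (G23.word_pair w)] (mod 3)"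
      using Cons by (intro cong_add cong_mult cong_pow s) (auto simp: G23.pcong_def)
    then show ?case
      unfolding A.word_pair_Cons G23.word_pair_Cons A.pmul_def G23.pmul_def G23.pcong_def fst fst_conv snd_conv
      by (simp only: cong_refl of_nat_numeral simp_thms)
  qed (simp only: A.word_pair_Nil G23.word_pair_Nil G23.pcong_refl)
  then have "A.pcong (A.word_pair u) (A.word_pair v) \<longleftrightarrow> G23.pcong (G23.word_pair u) (G23.word_pair v)" for u v
    unfolding A.pcong_def G23.pcong_def cong_def by simp
  then have "pres_eq (metacyclic_relations 2 3 s) = pres_eq (metacyclic_relations 2 3 (-1))"
    by (intro ext) (simp add: A.pres_eq_iff G23.pres_eq_iff)
  then show ?thesis
    by (simp add: metacyclic_def G23_def presented_group_def pres_class_def fun_eq_iff)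
qed

context frobenius_pairs
begin

text \<open>An isomorphism gives order m n = 6 and noncommutativity, which rules out m = 1 and n =
  1; it remains to exclude n = 2.\<close>

lemma iso_G23_iff: "G \<cong> G23 \<longleftrightarrow> m = 2 \<and> n = 3"
proof
  assume iso: "G \<cong> G23"
  have ncomm: "\<not> comm_group G23"
  proof
    assume "comm_group G23"
    then interpret C: comm_group G23 .
    have "G23.elt (0, 1) \<otimes>\<^bsub>G23\<^esub> G23.elt (1, 0) = G23.elt (1, 0) \<otimes>\<^bsub>G23\<^esub> G23.elt (0, 1)"
      by (intro C.m_comm) auto
    then have "G23.pcong (1, - 1) (1, 1)"
      by (simp add: G23.elt_eq_iff G23.pmul_def flip: G23.elt_pmul)
    then show False by (simp add: G23.pcong_def cong_iff_dvd_diff)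
  qed
  have "m * n = 6"
    using iso_same_card[OF iso] card_carrier G23.card_carrier by simp
  moreover have "m \<noteq> 1" "n \<noteq> 1"
    using comm_group_if_degenerate comm_group.iso_imp_comm_group[OF _ iso] ncomm
      G23.G.monoid_axioms by blast+
  \<comment> \<open>For n = 2 both \<open>s\<close> and \<open>s - 1\<close> would have to be
    odd.\<close>
  moreover have "n \<noteq> 2"
  proof
    assume "n = 2"
    moreover have "\<not> even (s - 1)"
      using s_unit[of 1] \<open>n = 2\<close> \<open>m * n = 6\<close> by (simp add: coprime_right_2_iff_odd)
    moreover have "odd s" using coprime_s \<open>n = 2\<close> by (simp add: coprime_right_2_iff_odd)
    ultimately show False by simp
  qed
  moreover have "m dvd 6" "n dvd 6" using \<open>m * n = 6\<close> by (metis dvd_triv_left dvd_triv_right)+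
  then have "m \<in> {..6}" "n \<in> {..6}" using dvd_imp_le by (metis atMost_iff zero_less_numeral)+
  ultimately show "m = 2 \<and> n = 3"
    by (simp add: atMost_nat_numeral atMost_Suc) auto
next
  assume "m = 2 \<and> n = 3"
  then have "G = G23" using metacyclic_2_3[OF s_cong_minus_one] by simp
  then show "G \<cong> G23" by simp
qed

end

section \<open>From the hypothesis on orders to the theorem\<close>

text \<open>If \<open>s ^ i - 1\<close> shared a prime q with \<open>n\<close>, then
  \<open>s\<close> would have order at most i < m modulo q. This is where the assumption on all
  prime divisors enters.\<close>

lemma frobenius_pairs_of_ord:
  fixes m n :: nat and s :: int
  assumes "m > 0" "n > 0" "coprime s (int n)" "ord (int n) s = m"
    and q: "\<And>q. prime q \<Longrightarrow> q dvd n \<Longrightarrow> ord (int q) s = m"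
  shows "frobenius_pairs m n s"
proof
  \<comment> \<open>As m > 0, an order equal to \<open>m\<close> is a genuine minimum and not the
    default value 0.\<close>
  have ord_props: "k > 0 \<Longrightarrow> [s ^ k = 1] (mod int l) \<Longrightarrow> m \<le> k" if "ord (int l) s = m" for k l
    using that \<open>m > 0\<close> by (auto simp: ord_def intro: Least_le split: if_splits)
  \<comment> \<open>Euler's theorem is applied to the natural representative \<open>t\<close>, to
    show that the minimum in the definition of \<open>ord\<close> is attained.\<close>
  define t where "t = nat (s mod int n)"
  have t: "int t = s mod int n" using assms(2) by (simp add: t_def)
  have "coprime (int t) (int n)" unfolding t using assms(2,3) by (simp add: coprime_mod_left_iff)
  then have "[t ^ totient n = 1] (mod n)" by (intro euler_theorem) simp
  then have "[int t ^ totient n = 1] (mod int n)"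
    by (metis cong_int_iff of_nat_1 of_nat_power)
  then have "[s ^ totient n = 1] (mod int n)"
    unfolding t cong_def by (simp add: power_mod)
  then have "(\<lambda>d. d > 0 \<and> [s ^ d = 1] (mod int n)) (totient n)" using assms(2) by simp
  then have "(\<lambda>d. d > 0 \<and> [s ^ d = 1] (mod int n)) (LEAST d. d > 0 \<and> [s ^ d = 1] (mod int n))"
    by (rule LeastI)
  moreover have "(LEAST d. d > 0 \<and> [s ^ d = 1] (mod int n)) = m"
    using assms(3,4) by (simp add: ord_def coprime_commute)
  ultimately show "[s ^ m = 1] (mod int n)" by simp
  fix i assume i: "0 < i" "i < m"
  show "coprime (s ^ i - 1) (int n)"
  proof (rule ccontr)
    assume "\<not> coprime (s ^ i - 1) (int n)"
    then have "\<bar>gcd (s ^ i - 1) (int n)\<bar> \<noteq> 1" by (simp add: coprime_iff_gcd_eq_1)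
    then obtain p where p: "prime p" "p dvd gcd (s ^ i - 1) (int n)"
      using prime_factor_int by blast
    define q where "q = nat p"
    have qp: "int q = p" using p(1) by (simp add: q_def prime_ge_0_int)
    then have "prime q" using p(1) by (simp flip: qp)
    moreover have "q dvd n" using p(2) qp by (metis dvd_trans gcd_dvd2 int_dvd_int_iff)
    ultimately have "ord (int q) s = m" by (rule q)
    moreover have "[s ^ i = 1] (mod int q)"
      using p(2) unfolding qp cong_iff_dvd_diff by simp
    ultimately have "m \<le> i" using i(1) by (intro ord_props)
    with i(2) show False by simp
  qed
qed (use assms in auto)

theorem theorem1p2:
  fixes m n :: nat and s :: int
  defines "G \<equiv> metacyclic m n s"
    and "x \<equiv> gen_x m n s"
    and "y \<equiv> gen_y m n s"
  assumes "m > 0" and "n > 0"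
    and "coprime s (int n)"
    and "ord (int n) s = m"
    and "\<And>q. prime q \<Longrightarrow> q dvd n \<Longrightarrow> ord (int q) s = m"
  shows "small_davenport G = m + n - 2 \<and>
    (\<forall>S. seq_over G S \<and> size S = small_davenport G \<longrightarrow>
      (product_one_free G S \<longleftrightarrow>
        (\<not> G \<cong> G23 \<longrightarrow>
          (\<exists>(a::nat) (c::nat) (b::nat \<Rightarrow> nat). gcd a m = 1 \<and> gcd c n = 1 \<and>
             S = image_mset (\<lambda>i. x [^]\<^bsub>G\<^esub> a \<otimes>\<^bsub>G\<^esub> y [^]\<^bsub>G\<^esub> b i) (mset_set {1..m - 1})
                 + replicate_mset (n - 1) (y [^]\<^bsub>G\<^esub> c))) \<and>
        (G \<cong> G23 \<longrightarrow>
          S = {# x, x \<otimes>\<^bsub>G\<^esub> y, x \<otimes>\<^bsub>G\<^esub> y [^]\<^bsub>G\<^esub> (2::nat) #} \<or>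
          (\<exists>b\<in>{0, 1, 2::nat}. \<exists>c\<in>{1, 2::nat}.
             S = {# x \<otimes>\<^bsub>G\<^esub> y [^]\<^bsub>G\<^esub> b #} + replicate_mset 2 (y [^]\<^bsub>G\<^esub> c)))))"
proof -
  interpret F: frobenius_pairs m n s
    using assms by (intro frobenius_pairs_of_ord) auto
  note F_simps = G_def x_def y_def
  define standard where "standard S \<longleftrightarrow> (\<exists>(a::nat) (c::nat) (b::nat \<Rightarrow> nat). gcd a m = 1 \<and> gcd c n = 1 \<and>
             S = image_mset (\<lambda>i. x [^]\<^bsub>G\<^esub> a \<otimes>\<^bsub>G\<^esub> y [^]\<^bsub>G\<^esub> b i) (mset_set {1..m - 1})
                 + replicate_mset (n - 1) (y [^]\<^bsub>G\<^esub> c))" for S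
  let ?E = "{# x, x \<otimes>\<^bsub>G\<^esub> y, x \<otimes>\<^bsub>G\<^esub> y [^]\<^bsub>G\<^esub> (2::nat) #}"
  have std: "product_one_free G S" if std: "standard S" for S
  proof -
    obtain a c :: nat and b :: "nat \<Rightarrow> nat" where ac: "gcd a m = 1" "gcd c n = 1"
      and S: "S = image_mset (\<lambda>i. x [^]\<^bsub>G\<^esub> a \<otimes>\<^bsub>G\<^esub> y [^]\<^bsub>G\<^esub> b i) (mset_set {1..m - 1})
                 + replicate_mset (n - 1) (y [^]\<^bsub>G\<^esub> c)"
      using std unfolding standard_def by (elim exE conjE) (rule that)
    show ?thesis unfolding S F_simps by (rule F.standard_product_one_free[OF ac])
  qed
  have exc: "product_one_free G ?E" if "m = 2" "n = 3"
    using F.exceptional_product_one_free[OF that] unfolding F_simps .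
  have cases: "standard S \<or> (m = 2 \<and> n = 3 \<and> S = ?E)"
    if "seq_over G S" "size S = m + n - 2" "product_one_free G S" for S
    using F.product_one_free_cases that unfolding standard_def F_simps by blast
  \<comment> \<open>For m = 2 and n = 3 the general form is the second exceptional form after
    reducing exponents: a is odd, so x^a = x, and c is 1 or 2 modulo 3.\<close>
  have std23: "standard S \<longleftrightarrow> (\<exists>b\<in>{0, 1, 2::nat}. \<exists>c\<in>{1, 2::nat}.
             S = {# x \<otimes>\<^bsub>G\<^esub> y [^]\<^bsub>G\<^esub> b #} + replicate_mset 2 (y [^]\<^bsub>G\<^esub> c))" if mn: "m = 2" "n = 3" for S
  proof
    assume "standard S"
    then obtain a c :: nat and b :: "nat \<Rightarrow> nat" where ac: "gcd a 2 = 1" "gcd c 3 = 1"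
      and S: "S = {# x [^]\<^bsub>G\<^esub> a \<otimes>\<^bsub>G\<^esub> y [^]\<^bsub>G\<^esub> b 1 #} + replicate_mset 2 (y [^]\<^bsub>G\<^esub> c)"
      unfolding standard_def mn by auto
    have red: "x [^]\<^bsub>G\<^esub> i \<otimes>\<^bsub>G\<^esub> y [^]\<^bsub>G\<^esub> j = x [^]\<^bsub>G\<^esub> (i mod 2) \<otimes>\<^bsub>G\<^esub> y [^]\<^bsub>G\<^esub> (j mod 3)" for i j :: nat
    proof -
      have "F.pcong (i, int j) (i mod 2, int (j mod 3))"
        unfolding F.pcong_def using mn by (simp add: zmod_int)
      then show ?thesis unfolding F_simps by (rule F.elt_cong[of "(i, int j)" "(i mod 2, int (j mod 3))" for i j, unfolded F.elt_nat])
    qed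
    have "coprime a 2" using ac(1) by (simp only: coprime_iff_gcd_eq_1)
    then have "a mod 2 = 1" by (simp add: coprime_right_2_iff_odd odd_iff_mod_2_eq_one)
    moreover have "c mod 3 \<noteq> 0"
    proof
      assume "c mod 3 = 0"
      then have "gcd c 3 = 3" by (intro gcd_nat.absorb2) (simp add: mod_0_imp_dvd)
      with ac(2) show False by simp
    qed
    then have "c mod 3 \<in> {1, 2}" by auto
    moreover have "b 1 mod 3 \<in> {0, 1, 2}" by auto
    moreover have "S = {# x \<otimes>\<^bsub>G\<^esub> y [^]\<^bsub>G\<^esub> (b 1 mod 3) #} + replicate_mset 2 (y [^]\<^bsub>G\<^esub> (c mod 3))"
      using S red[of a "b 1"] red[of 0 c] \<open>a mod 2 = 1\<close> by (simp add: F_simps)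
    ultimately show "\<exists>b\<in>{0, 1, 2::nat}. \<exists>c\<in>{1, 2::nat}.
             S = {# x \<otimes>\<^bsub>G\<^esub> y [^]\<^bsub>G\<^esub> b #} + replicate_mset 2 (y [^]\<^bsub>G\<^esub> c)"
      by (intro bexI[of _ "b 1 mod 3"] bexI[of _ "c mod 3"])
  next
    assume "\<exists>b\<in>{0, 1, 2::nat}. \<exists>c\<in>{1, 2::nat}.
             S = {# x \<otimes>\<^bsub>G\<^esub> y [^]\<^bsub>G\<^esub> b #} + replicate_mset 2 (y [^]\<^bsub>G\<^esub> c)"
    then obtain b c :: nat where "c \<in> {1, 2}"
      and S: "S = {# x \<otimes>\<^bsub>G\<^esub> y [^]\<^bsub>G\<^esub> b #} + replicate_mset 2 (y [^]\<^bsub>G\<^esub> c)" by (elim bexE) (rule that)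
    then have "gcd c 3 = 1" by auto
    then show "standard S"
      unfolding standard_def mn S
      by (intro exI[of _ 1] exI[of _ c] exI[of _ "\<lambda>_. b"]) (simp add: F_simps)
  qed
  have sd: "small_davenport G = m + n - 2"
    using F.small_davenport_eq by (simp add: G_def)
  moreover have "product_one_free G S \<longleftrightarrow>
        (\<not> G \<cong> G23 \<longrightarrow> standard S) \<and>
        (G \<cong> G23 \<longrightarrow>
          S = ?E \<or>
          (\<exists>b\<in>{0, 1, 2::nat}. \<exists>c\<in>{1, 2::nat}.
             S = {# x \<otimes>\<^bsub>G\<^esub> y [^]\<^bsub>G\<^esub> b #} + replicate_mset 2 (y [^]\<^bsub>G\<^esub> c)))"
    if "seq_over G S" "size S = m + n - 2" for S
  proof (cases "m = 2 \<and> n = 3")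
    case True
    then have "G \<cong> G23" using F.iso_G23_iff by (simp add: G_def)
    with True std exc cases[OF that] std23 show ?thesis by blast
  next
    case False
    then have "\<not> G \<cong> G23" using F.iso_G23_iff by (simp add: G_def)
    with False std cases[OF that] show ?thesis by blast
  qed
  ultimately show ?thesis
    unfolding standard_def by simp
qed

end
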